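(* Let $\mathcal{S}=((X,d),(f_i)_{i\in I})$ be an iterated function system. The following statements are equivalent: 1. There exists a comparison function $\varphi$ such that $\mathcal{S}$ is hyperbolic $\varphi$-contractive. 2. $\mathcal{S}$ is hyperbolic locally uniformly point fibred. 3. $\mathcal{S}$ is hyperbolic uniformly point fibred. 4. $\mathcal{S}$ is a hyperbolic diameter diminishing to zero iterated function system. 5. $\mathcal{S}$ has hyperbolic attractor, with attractor denoted $A_{\mathcal{S}}$ (that is, there is a metric $d_1$ on $X$, topologically equivalent to $d$ and complete, such that $((X,d_1),(f_i)_{i\in I})$ is an iterated function system having attractor $A_{\mathcal{S}}$), and there exists a continuous surjection $\pi:\Lambda(I)\rightarrow A_{\mathcal{S}}$ such that $f_i\circ\pi=\pi\circ\tau_i$ for all $i\in I$.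
   Context: Metric spaces are nonempty. For a metric space $(X,d)$, $P_b(X)$ is the set of nonempty bounded subsets of $X$, $P_{b,cl}(X)$ the set of nonempty bounded closed subsets, and $H_d$ the Hausdorff-Pompeiu metric on $P_{b,cl}(X)$, $H_d(A,B)=\max\{\sup_{x\in A}d(x,B),\sup_{x\in B}d(x,A)\}$, where $d(x,A)=\inf_{y\in A}d(x,y)$. An iterated function system (IFS) is a pair $\mathcal{S}=((X,d),(f_i)_{i\in I})$ where $(X,d)$ is a complete metric space, $I$ is a nonempty finite set, each $f_i:X\to X$ is continuous, and $f_i(B)\in P_b(X)$ for every $B\in P_b(X)$ and $i\in I$. Its fractal operator $F_{\mathcal{S}}:P_{b,cl}(X)\to P_{b,cl}(X)$ is $F_{\mathcal{S}}(B)=\overline{\bigcup_{i\in I}f_i(B)}$; $F_{\mathcal{S}}^{[n]}$ is its $n$-fold composition. $\mathbb{N}^*=\{1,2,\dots\}$. $\Lambda(I)=I^{\mathbb{N}^*}$ is the set of infinite words $\omega=\omega_1\omega_2\dots$ over $I$, with the metric $d_\Lambda(\omega,\theta)=0$ if $\omega=\theta$ and $d_\Lambda(\omega,\theta)=2^{-\min\{k\in\mathbb{N}^*\mid\omega_k\neq\theta_k\}}$ otherwise. $\Lambda_n(I)$ is the set of words of length $n$ over $I$; $[\omega]_n=\omega_1\dots\omega_n$ for $\omega\in\Lambda(I)$; $f_{\omega}=f_{\omega_1}\circ\dots\circ f_{\omega_n}$ for $\omega=\omega_1\dots\omega_n\in\Lambda_n(I)$. For $i\in I$, $\tau_i:\Lambda(I)\to\Lambda(I)$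 is $\tau_i(\omega)=i\omega$ (concatenation). A comparison function is $\varphi:[0,\infty)\to[0,\infty)$ which is increasing, right-continuous and satisfies $\varphi(t)<t$ for every $t>0$. For an IFS $\mathcal{S}=((X,d),(f_i)_{i\in I})$: - $\mathcal{S}$ is $\varphi$-contractive (for a comparison function $\varphi$) if $d(f_i(x),f_i(y))\leq\varphi(d(x,y))$ for all $x,y\in X$, $i\in I$. - $\mathcal{S}$ is point fibred if for every $\omega\in\Lambda(I)$ there is $a_\omega\in X$ such that $\lim_{n\to\infty}f_{[\omega]_n}(x)=a_\omega$ for all $x\in X$. - $\mathcal{S}$ is locally uniformly point fibred if it is point fibred and each $x\in X$ has an open set $D_x$ containing $x$ such that $\lim_{n\to\infty}\sup_{\omega\in\Lambda(I)}\sup_{y\in D_x}d(f_{[\omega]_n}(y),a_\omega)=0$. - $\mathcal{S}$ is uniformly point fibred if it is point fibred and $\lim_{n\to\infty}\sup_{\omega\in\Lambda(I)}\sup_{x\in B}d(f_{[\omega]_n}(x),a_\omega)=0$ for every $B\in P_{b,cl}(X)$. - $\mathcal{S}$ has an attractor if there exists $A_{\mathcal{S}}\in P_{b,cl}(X)$ with $F_{\mathcal{S}}(A_{\mathcal{S}})=A_{\mathcal{S}}$ and $\lim_{n\to\infty}H_d(F_{\mathcal{S}}^{[n]}(B),A_{\mathcal{S}})=0$ for each $B\in P_{b,cl}(X)$; $A_{\mathcal{S}}$ (which is unique) is called the attractor. - $\mathcal{S}$ is diameter diminishing to zero if for every $B\in P_{b,cl}(X)$ there exists $M_B\in P_{b,cl}(X)$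 such that $B\subseteq M_B$, $F_{\mathcal{S}}(M_B)\subseteq M_B$ and $\lim_{n\to\infty}\max_{\omega\in\Lambda_n(I)}\mathrm{diam}(f_\omega(M_B))=0$. For each of these properties $P$, $\mathcal{S}=((X,d),(f_i)_{i\in I})$ is said to be hyperbolic $P$ (for the attractor property: to have hyperbolic attractor) if there exists a metric $d_1$ on $X$ such that $d$ and $d_1$ are topologically equivalent (induce the same topology), $(X,d_1)$ is complete, and $\mathcal{S}_1=((X,d_1),(f_i)_{i\in I})$ is an IFS with property $P$ (all notions, including bounded sets, $P_{b,cl}(X)$, diameters and $H_{d_1}$, taken with respect to $d_1$). *)

theory Defs
  imports "HOL-Analysis.Analysis"
begin

section \<open>Words\<close>

text \<open>Positions are shifted by one: \<open>\<omega> k\<close> is the letter written $\omega_{k+1}$ on paper,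
  whence the \<open>Suc\<close> in the exponent of the metric.\<close>

definition inf_words :: "'i set \<Rightarrow> (nat \<Rightarrow> 'i) set"
  where "inf_words I = {\<omega>. \<forall>k. \<omega> k \<in> I}"

definition word_dist :: "(nat \<Rightarrow> 'i) \<Rightarrow> (nat \<Rightarrow> 'i) \<Rightarrow> real"
  where "word_dist \<omega> \<theta> =
    (if \<omega> = \<theta> then 0 else (1 / 2) ^ Suc (LEAST k. \<omega> k \<noteq> \<theta> k))"

definition fin_words :: "nat \<Rightarrow> 'i set \<Rightarrow> 'i list set"
  where "fin_words n I = {w. set w \<subseteq> I \<and> length w = n}"

definition prefix_word :: "(nat \<Rightarrow> 'i) \<Rightarrow> nat \<Rightarrow> 'i list"
  where "prefix_word \<omega> n = map \<omega> [0..<n]"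

definition shift_in :: "'i \<Rightarrow> (nat \<Rightarrow> 'i) \<Rightarrow> (nat \<Rightarrow> 'i)"
  where "shift_in i \<omega> = case_nat i \<omega>"

fun word_map :: "('i \<Rightarrow> 'a \<Rightarrow> 'a) \<Rightarrow> 'i list \<Rightarrow> 'a \<Rightarrow> 'a"
  where
    "word_map f [] = id"
  | "word_map f (i # w) = f i \<circ> word_map f w"

lemma Metric_space_words: "Metric_space (inf_words I) word_dist"
proof
  fix \<omega> \<theta> \<xi> :: "nat \<Rightarrow> 'i"
  show "0 \<le> word_dist \<omega> \<theta>"
    by (simp add: word_dist_def)
  show "word_dist \<omega> \<theta> = word_dist \<theta> \<omega>"
    unfolding word_dist_def by (simp add: eq_commute[of "\<omega> _"] eq_commute[of \<omega>])
  show "(word_dist \<omega> \<theta> = 0) = (\<omega> = \<theta>)"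
    by (simp add: word_dist_def)
  show "word_dist \<omega> \<xi> \<le> word_dist \<omega> \<theta> + word_dist \<theta> \<xi>"
  proof (cases "\<omega> = \<xi> \<or> \<omega> = \<theta> \<or> \<theta> = \<xi>")
    case True
    then show ?thesis by (auto simp: word_dist_def)
  next
    case False
    define m where "m = (LEAST k. \<omega> k \<noteq> \<xi> k)"
    have "\<exists>k. \<omega> k \<noteq> \<xi> k" using False by auto
    then have "\<omega> m \<noteq> \<xi> m" unfolding m_def by (rule LeastI_ex)
    then have "\<omega> m \<noteq> \<theta> m \<or> \<theta> m \<noteq> \<xi> m" by auto
    then have "(LEAST k. \<omega> k \<noteq> \<theta> k) \<le> m \<or> (LEAST k. \<theta> k \<noteq> \<xi> k) \<le> m"
      by (auto intro: Least_le)
    then have "(1 / 2 :: real) ^ Suc m \<le> (1 / 2) ^ Suc (LEAST k. \<omega> k \<noteq> \<theta> k) \<or>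
               (1 / 2 :: real) ^ Suc m \<le> (1 / 2) ^ Suc (LEAST k. \<theta> k \<noteq> \<xi> k)"
      by (auto intro: power_decreasing simp del: power_Suc)
    moreover have "0 \<le> (1 / 2 :: real) ^ Suc (LEAST k. \<omega> k \<noteq> \<theta> k)"
      "0 \<le> (1 / 2 :: real) ^ Suc (LEAST k. \<theta> k \<noteq> \<xi> k)"
      by simp_all
    ultimately show ?thesis
      using False unfolding word_dist_def m_def[symmetric] by (simp only: de_Morgan_disj simp_thms if_False) linarith
  qed
qed


section \<open>Bounded sets and the Hausdorff-Pompeiu metric\<close>

context Metric_space
begin

definition Pb :: "'a set set"
  where "Pb = {B. B \<noteq> {} \<and> mbounded B}"

definition Pbcl :: "'a set set"
  where "Pbcl = {B. B \<noteq> {} \<and> mbounded B \<and> closedin mtopology B}"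

definition set_dist :: "'a \<Rightarrow> 'a set \<Rightarrow> real"
  where "set_dist x A = (INF y\<in>A. d x y)"

text \<open>The real-valued suprema below are the intended ones for nonempty bounded arguments;
  these are the only ones to which the two functions are applied.\<close>

definition Hausdorff_dist :: "'a set \<Rightarrow> 'a set \<Rightarrow> real"
  where "Hausdorff_dist A B = max (SUP x\<in>A. set_dist x B) (SUP x\<in>B. set_dist x A)"

definition diam :: "'a set \<Rightarrow> real"
  where "diam A = (SUP (x, y)\<in>A \<times> A. d x y)"

end


section \<open>Iterated function systems\<close>

definition comparison_function :: "(real \<Rightarrow> real) \<Rightarrow> bool"
  where "comparison_function \<phi> \<longleftrightarrow>
    \<phi> ` {0..} \<subseteq> {0..} \<and> mono_on {0..} \<phi> \<and>
    (\<forall>t\<ge>0. continuous (at_right t) \<phi>) \<and> (\<forall>t>0. \<phi> t < t)"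

locale IFS = Metric_space X d for X :: "'a set" and d +
  fixes I :: "'i set" and f :: "'i \<Rightarrow> 'a \<Rightarrow> 'a"
  assumes X_nonempty: "X \<noteq> {}"
    and complete: "mcomplete"
    and I_finite: "finite I"
    and I_nonempty: "I \<noteq> {}"
    and continuous_f: "\<And>i. i \<in> I \<Longrightarrow> continuous_map mtopology mtopology (f i)"
    and bounded_f: "\<And>i B. i \<in> I \<Longrightarrow> B \<in> Pb \<Longrightarrow> f i ` B \<in> Pb"
begin

definition fractal_operator :: "'a set \<Rightarrow> 'a set"
  where "fractal_operator B = mtopology closure_of (\<Union>i\<in>I. f i ` B)"

definition phi_contractive :: "(real \<Rightarrow> real) \<Rightarrow> bool"
  where "phi_contractive \<phi> \<longleftrightarrow> (\<forall>i\<in>I. \<forall>x\<in>X. \<forall>y\<in>X. d (f i x) (f i y) \<le> \<phi> (d x y))"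

definition fibre_limit :: "(nat \<Rightarrow> 'i) \<Rightarrow> 'a \<Rightarrow> bool"
  where "fibre_limit \<omega> a \<longleftrightarrow>
    a \<in> X \<and>
    (\<forall>x\<in>X. limitin mtopology (\<lambda>n. word_map f (prefix_word \<omega> n) x) a sequentially)"

definition point_fibred :: bool
  where "point_fibred \<longleftrightarrow> (\<forall>\<omega>\<in>inf_words I. \<exists>a. fibre_limit \<omega> a)"

definition fibre_point :: "(nat \<Rightarrow> 'i) \<Rightarrow> 'a"
  where "fibre_point \<omega> = (THE a. fibre_limit \<omega> a)"

lemma fibre_limit_unique: "fibre_limit \<omega> a \<Longrightarrow> fibre_limit \<omega> b \<Longrightarrow> a = b"
  unfolding fibre_limit_def
  using X_nonempty limitin_metric_unique trivial_limit_sequentially by blast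

lemma fibre_limit_fibre_point:
  "point_fibred \<Longrightarrow> \<omega> \<in> inf_words I \<Longrightarrow> fibre_limit \<omega> (fibre_point \<omega>)"
  unfolding point_fibred_def fibre_point_def
  by (metis fibre_limit_unique theI)

text \<open>The suprema over words and over a neighbourhood may be infinite for some \<open>n\<close>;
  they are therefore taken in \<^typ>\<open>ennreal\<close>.\<close>

definition max_deviation :: "'a set \<Rightarrow> nat \<Rightarrow> ennreal"
  where "max_deviation D n =
    (SUP \<omega>\<in>inf_words I. SUP y\<in>D.
       ennreal (d (word_map f (prefix_word \<omega> n) y) (fibre_point \<omega>)))"

definition locally_uniformly_point_fibred :: bool
  where "locally_uniformly_point_fibred \<longleftrightarrow>
    point_fibred \<and>
    (\<forall>x\<in>X. \<exists>D. openin mtopology D \<and> x \<in> D \<and> max_deviation D \<longlonglongrightarrow> 0)"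

definition uniformly_point_fibred :: bool
  where "uniformly_point_fibred \<longleftrightarrow>
    point_fibred \<and> (\<forall>B\<in>Pbcl. max_deviation B \<longlonglongrightarrow> 0)"

definition is_attractor :: "'a set \<Rightarrow> bool"
  where "is_attractor A \<longleftrightarrow>
    A \<in> Pbcl \<and> fractal_operator A = A \<and>
    (\<forall>B\<in>Pbcl. (\<lambda>n. Hausdorff_dist ((fractal_operator ^^ n) B) A) \<longlonglongrightarrow> 0)"

definition diameter_diminishing :: bool
  where "diameter_diminishing \<longleftrightarrow>
    (\<forall>B\<in>Pbcl. \<exists>M\<in>Pbcl. B \<subseteq> M \<and> fractal_operator M \<subseteq> M \<and>
       (\<lambda>n. Max ((\<lambda>w. diam (word_map f w ` M)) ` fin_words n I)) \<longlonglongrightarrow> 0)"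

end

text \<open>\<open>hyperbolic X d I f P\<close>: some complete metric on \<open>X\<close>, topologically equivalent to \<open>d\<close>,
  makes the maps \<open>f\<close> an IFS and satisfies \<open>P\<close>.  Completeness is part of \<^const>\<open>IFS\<close>.\<close>

definition hyperbolic ::
  "'a set \<Rightarrow> ('a \<Rightarrow> 'a \<Rightarrow> real) \<Rightarrow> 'i set \<Rightarrow> ('i \<Rightarrow> 'a \<Rightarrow> 'a) \<Rightarrow>
   (('a \<Rightarrow> 'a \<Rightarrow> real) \<Rightarrow> bool) \<Rightarrow> bool"
  where "hyperbolic X d I f P \<longleftrightarrow>
    (\<exists>d1. IFS X d1 I f \<and> Metric_space.mtopology X d1 = Metric_space.mtopology X d \<and> P d1)"

end

theory Submission
  imports Defs
begin

text \<open>All five properties express, each in its own way, that long words of maps contract \<open>X\<close>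
  locally uniformly onto the set of fibre points \<open>a\<^sub>\<omega>\<close>.  Every implication proved below holds for one
  and the same metric, except the one from locally uniformly point fibred to \<open>\<phi>\<close>-contractive; this is
  the place where the metric has to be replaced.

  A \<open>\<phi>\<close>-contractive system is uniformly point fibred (\<open>phi_contractive_imp_uniformly_point_fibred\<close>): if
  \<open>\<phi>\<^sup>k\<close> sends the largest displacement \<open>d x\<^sub>0 (f i x\<^sub>0)\<close> below \<open>\<eta> - \<phi> \<eta>\<close>, then by induction on \<open>u\<close> the
  point \<open>f\<^sub>u x\<^sub>0\<close> stays within \<open>\<eta>\<close> of the image of \<open>x\<^sub>0\<close> under the prefix of \<open>u\<close> of length \<open>k\<close>.  Hence
  the images along the prefixes of \<open>\<omega>\<close> form a Cauchy sequence, uniformly in \<open>\<omega>\<close>.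

  Uniformly point fibred systems are diameter diminishing, because the closure of the orbit of \<open>B\<close> under
  all finite words is a bounded forward invariant set.  Conversely, for such a set \<open>M\<close> the sets \<open>f\<^sub>w M\<close>
  along the prefixes \<open>w\<close> of \<open>\<omega>\<close> are nested and their diameters tend to 0.

  In a uniformly point fibred system the map sending \<open>\<omega>\<close> to its fibre point is continuous on a compact
  space and conjugates the shifts to the maps \<open>f i\<close>; its image is the attractor.  A system whose
  attractor \<open>A\<close> is parametrized in this way is in turn locally uniformly point fibred
  (\<open>attractor_imp_locally_uniformly_point_fibred\<close>): the image \<open>f\<^sub>u A\<close> is small for long \<open>u\<close>, hence so is
  that of a neighbourhood of \<open>A\<close>, and every ball enters this neighbourhood after sufficiently many maps.

  The substance of the theorem is the way back from a locally uniformly point fibred system to a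
  \<open>\<phi>\<close>-contractive one, which takes two changes of metric.  The first,
  \<open>e x y = (SUP w. c\<^bsub>|w|\<^esub> * min 1 (d (f\<^sub>w x) (f\<^sub>w y)))\<close> with weights \<open>c\<^sub>n\<close> increasing strictly from 1
  towards 2, makes all maps nonexpansive, and contractive on a neighbourhood \<open>W\<close> of the compact fibre
  set on which long words shrink uniformly (\<open>nonexpansive_metric\<close>).  The second adds to \<open>e\<close> a term
  \<open>SUP w. 2\<^bsup>|w|\<^esup> * p (f\<^sub>w x) (f\<^sub>w y)\<close>, where \<open>p \<le> e\<close> is a pseudometric that collapses a smaller
  neighbourhood \<open>V\<close> of the fibre set (\<open>remetrize_contractive\<close>).  Each point has a neighbourhood that all
  words from some length on map into \<open>V\<close>, so only finitely many lengths of words contribute there and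
  the topology does not change.  The added term is halved by every map, and it dominates \<open>e\<close> up to a
  factor on pairs of points not both in \<open>W\<close>, which makes the sum contractive everywhere.\<close>

section \<open>Words\<close>

lemma fin_words_eq: "fin_words n I = {w \<in> lists I. length w = n}"
  by (auto simp: fin_words_def)

lemma finite_fin_words: "finite I \<Longrightarrow> finite (fin_words n I)"
  unfolding fin_words_def by (rule finite_lists_length_eq)

lemma fin_words_nonempty: "I \<noteq> {} \<Longrightarrow> fin_words n I \<noteq> {}"
proof -
  assume "I \<noteq> {}"
  then obtain c where "c \<in> I" by blast
  then have "replicate n c \<in> fin_words n I" by (auto simp: fin_words_def)
  then show ?thesis by blast
qed

lemma word_map_append: "word_map f (u @ v) x = word_map f u (word_map f v x)"
  by (induction u) auto

lemma length_prefix_word [simp]: "length (prefix_word \<omega> n) = n"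
  by (simp add: prefix_word_def)

lemma prefix_word_in_lists: "\<omega> \<in> inf_words I \<Longrightarrow> prefix_word \<omega> n \<in> lists I"
  by (auto simp: prefix_word_def inf_words_def)

lemma prefix_word_eq_iff: "prefix_word \<omega> n = prefix_word \<theta> n \<longleftrightarrow> (\<forall>k<n. \<omega> k = \<theta> k)"
  by (auto simp: prefix_word_def)

lemma prefix_word_shift_in: "prefix_word (shift_in i \<omega>) (Suc n) = i # prefix_word \<omega> n"
  unfolding prefix_word_def shift_in_def
  by (subst upt_conv_Cons) (simp_all add: map_Suc_upt[symmetric] comp_def del: upt_Suc)

lemma prefix_word_add:
  "prefix_word \<omega> (n + m) = prefix_word \<omega> n @ prefix_word (\<lambda>k. \<omega> (n + k)) m"
  unfolding prefix_word_def
  by (rule nth_equalityI) (auto simp: nth_append)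

lemma shift_in_inf_words: "i \<in> I \<Longrightarrow> \<omega> \<in> inf_words I \<Longrightarrow> shift_in i \<omega> \<in> inf_words I"
  by (auto simp: inf_words_def shift_in_def split: nat.splits)

lemma inf_words_decompose:
  assumes "\<omega> \<in> inf_words I"
  obtains i \<theta> where "i \<in> I" "\<theta> \<in> inf_words I" "\<omega> = shift_in i \<theta>"
proof
  show "\<omega> 0 \<in> I" "(\<lambda>k. \<omega> (Suc k)) \<in> inf_words I"
    using assms by (auto simp: inf_words_def)
  show "\<omega> = shift_in (\<omega> 0) (\<lambda>k. \<omega> (Suc k))"
    by (auto simp: shift_in_def fun_eq_iff split: nat.splits)
qed

abbreviation prepend_word :: "'i list \<Rightarrow> (nat \<Rightarrow> 'i) \<Rightarrow> nat \<Rightarrow> 'i"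
  where "prepend_word \<equiv> foldr shift_in"

lemma prepend_word_inf_words:
  "w \<in> lists I \<Longrightarrow> \<omega> \<in> inf_words I \<Longrightarrow> prepend_word w \<omega> \<in> inf_words I"
  by (induction w) (auto intro: shift_in_inf_words)

lemma prefix_prepend_word: "length w = n \<Longrightarrow> prefix_word (prepend_word w \<omega>) n = w"
  by (induction w arbitrary: n) (auto simp: prefix_word_shift_in, simp add: prefix_word_def)

lemma prepend_prefix_word: "prepend_word (prefix_word \<omega> n) (\<lambda>k. \<omega> (n + k)) = \<omega>"
proof (induction n)
  case (Suc n)
  have "prefix_word \<omega> (Suc n) = prefix_word \<omega> n @ [\<omega> n]"
    by (simp add: prefix_word_def)
  moreover have "shift_in (\<omega> n) (\<lambda>k. \<omega> (Suc n + k)) = (\<lambda>k. \<omega> (n + k))"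
    by (auto simp: shift_in_def fun_eq_iff split: nat.splits)
  ultimately show ?case using Suc by simp
qed (simp add: prefix_word_def)

lemma shifted_inf_words: "\<omega> \<in> inf_words I \<Longrightarrow> (\<lambda>k. \<omega> (n + k)) \<in> inf_words I"
  by (auto simp: inf_words_def)

lemma extend_to_inf_word:
  assumes "w \<in> lists I" "I \<noteq> {}"
  obtains \<omega> where "\<omega> \<in> inf_words I" "prefix_word \<omega> (length w) = w"
proof -
  from \<open>I \<noteq> {}\<close> obtain c where "c \<in> I" by blast
  then have "(\<lambda>_. c) \<in> inf_words I" by (auto simp: inf_words_def)
  then show ?thesis
    using that[of "prepend_word w (\<lambda>_. c)"] assms prefix_prepend_word[OF refl]
    by (auto intro: prepend_word_inf_words)
qed

text \<open>The exponent \<open>Suc n\<close> is right because positions are counted from 0 while the metric counts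
  them from 1: two words first differing at index \<open>n\<close> have distance \<open>(1 / 2) ^ Suc n\<close>.\<close>

lemma word_dist_le_iff:
  "word_dist \<omega> \<theta> \<le> (1 / 2) ^ Suc n \<longleftrightarrow> prefix_word \<omega> n = prefix_word \<theta> n"
proof (cases "\<omega> = \<theta>")
  case False
  define L where "L = (LEAST k. \<omega> k \<noteq> \<theta> k)"
  have "\<exists>k. \<omega> k \<noteq> \<theta> k" using False by auto
  then have L: "\<omega> L \<noteq> \<theta> L" unfolding L_def by (rule LeastI_ex)
  have "\<omega> k = \<theta> k" if "k < L" for k using not_less_Least that unfolding L_def by blast
  with L have "(\<forall>k<n. \<omega> k = \<theta> k) \<longleftrightarrow> n \<le> L"
    by (meson leI le_less_trans less_le_trans)
  moreover have "word_dist \<omega> \<theta> \<le> (1 / 2) ^ Suc n \<longleftrightarrow> n \<le> L"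
    using False unfolding word_dist_def L_def[symmetric]
    by (subst if_not_P, simp, subst power_decreasing_iff) auto
  ultimately show ?thesis by (simp add: prefix_word_eq_iff)
qed (simp add: word_dist_def)

text \<open>The finitely many words that are constant from position \<open>n\<close> on with a fixed letter form a net of
  mesh \<open>(1 / 2) ^ Suc n\<close>, and the letters of a Cauchy sequence of words become stationary position
  by position.\<close>

lemma compact_space_words:
  assumes "finite I" "I \<noteq> {}"
  shows "compact_space (Metric_space.mtopology (inf_words I) word_dist)"
proof -
  interpret W: Metric_space "inf_words I" word_dist by (rule Metric_space_words)
  have small: "\<exists>n. (1 / 2) ^ Suc n < \<epsilon>" if "\<epsilon> > 0" for \<epsilon> :: real
  proof -
    from that obtain n where "(1 / 2) ^ n < \<epsilon>"
      using real_arch_pow_inv[of \<epsilon> "1/2"] by auto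
    moreover have "(1 / 2 :: real) ^ Suc n \<le> (1 / 2) ^ n" by simp
    ultimately show ?thesis by (meson le_less_trans)
  qed
  have "W.mtotally_bounded (inf_words I)"
    unfolding W.mtotally_bounded_def
  proof (intro allI impI)
    fix \<epsilon> :: real assume "\<epsilon> > 0"
    then obtain n where n: "(1 / 2) ^ Suc n < \<epsilon>" using small by blast
    from \<open>I \<noteq> {}\<close> obtain c where c: "c \<in> I" by blast
    define K where "K = (\<lambda>w. prepend_word w (\<lambda>_. c)) ` fin_words n I"
    have "finite K" unfolding K_def using assms by (simp add: finite_fin_words)
    moreover have K: "K \<subseteq> inf_words I"
    proof -
      have "(\<lambda>_. c) \<in> inf_words I" using c by (simp add: inf_words_def)
      then show ?thesis unfolding K_def fin_words_eq
        by (auto intro: prepend_word_inf_words)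
    qed
    moreover have "inf_words I \<subseteq> (\<Union>x\<in>K. W.mball x \<epsilon>)"
    proof
      fix \<omega> assume \<omega>: "\<omega> \<in> inf_words I"
      let ?\<theta> = "prepend_word (prefix_word \<omega> n) (\<lambda>_. c)"
      have "prefix_word \<omega> n \<in> fin_words n I"
        using prefix_word_in_lists[OF \<omega>] by (auto simp: fin_words_eq)
      then have "?\<theta> \<in> K" unfolding K_def by blast
      moreover have "word_dist ?\<theta> \<omega> < \<epsilon>"
        using word_dist_le_iff[of ?\<theta> \<omega> n] n prefix_prepend_word[of "prefix_word \<omega> n" n] by simp
      ultimately show "\<omega> \<in> (\<Union>x\<in>K. W.mball x \<epsilon>)" using K \<omega> by auto
    qed
    ultimately show "\<exists>K. finite K \<and> K \<subseteq> inf_words I \<and> inf_words I \<subseteq> (\<Union>x\<in>K. W.mball x \<epsilon>)"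
      by blast
  qed
  moreover have "W.mcomplete"
    unfolding W.mcomplete_def
  proof (intro allI impI)
    fix \<sigma> assume \<sigma>: "W.MCauchy \<sigma>"
    then have \<sigma>_in: "\<sigma> m \<in> inf_words I" for m by (auto simp: W.MCauchy_def)
    have "\<exists>N. \<forall>m\<ge>N. \<forall>m'\<ge>N. prefix_word (\<sigma> m) n = prefix_word (\<sigma> m') n" for n
    proof -
      have "(1 / 2 :: real) ^ Suc n > 0" by simp
      then obtain N where "\<And>m m'. N \<le> m \<Longrightarrow> N \<le> m' \<Longrightarrow> word_dist (\<sigma> m) (\<sigma> m') < (1 / 2) ^ Suc n"
        using \<sigma> unfolding W.MCauchy_def by blast
      then show ?thesis by (meson word_dist_le_iff less_imp_le)
    qed
    then have "\<forall>n. \<exists>N. \<forall>m\<ge>N. \<forall>m'\<ge>N. prefix_word (\<sigma> m) n = prefix_word (\<sigma> m') n"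
      by blast
    from choice[OF this] obtain N where
      N: "\<forall>n. \<forall>m\<ge>N n. \<forall>m'\<ge>N n. prefix_word (\<sigma> m) n = prefix_word (\<sigma> m') n"
      by blast
    define \<theta> where "\<theta> k = \<sigma> (N (Suc k)) k" for k
    have ev: "\<forall>\<^sub>F m in sequentially. \<sigma> m k = \<theta> k" for k
      unfolding eventually_sequentially \<theta>_def
    proof (intro exI allI impI)
      fix m assume "m \<ge> N (Suc k)"
      then have "prefix_word (\<sigma> m) (Suc k) = prefix_word (\<sigma> (N (Suc k))) (Suc k)"
        using N by blast
      then show "\<sigma> m k = \<sigma> (N (Suc k)) k" by (simp add: prefix_word_eq_iff)
    qed
    have \<theta>_in: "\<theta> \<in> inf_words I" using \<sigma>_in by (auto simp: \<theta>_def inf_words_def)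
    have "limitin W.mtopology \<sigma> \<theta> sequentially"
      unfolding W.limitin_metric
    proof (intro conjI allI impI \<theta>_in)
      fix \<epsilon> :: real assume "\<epsilon> > 0"
      then obtain n where n: "(1 / 2) ^ Suc n < \<epsilon>" using small by blast
      have "\<forall>\<^sub>F m in sequentially. \<forall>k\<in>{..<n}. \<sigma> m k = \<theta> k"
        by (rule eventually_ball_finite) (use ev in auto)
      then show "\<forall>\<^sub>F m in sequentially. \<sigma> m \<in> inf_words I \<and> word_dist (\<sigma> m) \<theta> < \<epsilon>"
      proof (rule eventually_mono)
        fix m assume "\<forall>k\<in>{..<n}. \<sigma> m k = \<theta> k"
        then have "prefix_word (\<sigma> m) n = prefix_word \<theta> n"
          by (simp add: prefix_word_eq_iff)
        then have "word_dist (\<sigma> m) \<theta> \<le> (1 / 2) ^ Suc n"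
          by (simp only: word_dist_le_iff)
        with n show "\<sigma> m \<in> inf_words I \<and> word_dist (\<sigma> m) \<theta> < \<epsilon>"
          using \<sigma>_in by (meson le_less_trans)
      qed
    qed
    then show "\<exists>x. limitin W.mtopology \<sigma> x sequentially" by blast
  qed
  ultimately show ?thesis by (simp add: W.compact_space_eq_mcomplete_mtotally_bounded)
qed

section \<open>Distances between sets and compactness\<close>

context Metric_space
begin

lemma set_dist_le: "a \<in> A \<Longrightarrow> set_dist x A \<le> d x a"
  unfolding set_dist_def by (rule cINF_lower) (auto intro: bdd_belowI[of _ 0])

lemma set_dist_nonneg: "A \<noteq> {} \<Longrightarrow> 0 \<le> set_dist x A"
  unfolding set_dist_def by (rule cINF_greatest) auto

lemma set_dist_lessD: "set_dist x A < e \<Longrightarrow> A \<noteq> {} \<Longrightarrow> \<exists>a\<in>A. d x a < e"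
  unfolding set_dist_def by (subst (asm) cINF_less_iff) (auto intro: bdd_belowI[of _ 0])

lemma set_dist_Lipschitz:
  assumes "A \<subseteq> M" "A \<noteq> {}" "x \<in> M" "y \<in> M"
  shows "set_dist x A \<le> d x y + set_dist y A"
proof -
  have "set_dist x A - d x y \<le> set_dist y A"
    unfolding set_dist_def[of y]
  proof (rule cINF_greatest[OF assms(2)])
    fix a assume "a \<in> A"
    then have "set_dist x A \<le> d x a" "d x a \<le> d x y + d y a"
      using set_dist_le triangle assms by blast+
    then show "set_dist x A - d x y \<le> d y a" by simp
  qed
  then show ?thesis by simp
qed

lemma Hausdorff_dist_lessD:
  assumes "Hausdorff_dist A B < e" "mbounded A" "mbounded B" "B \<noteq> {}" "x \<in> A"
  shows "\<exists>b\<in>B. d x b < e"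
proof -
  obtain b where b: "b \<in> B" using assms by blast
  from assms have "mbounded (A \<union> B)" by (simp add: mbounded_Un)
  then obtain C where C: "\<And>x y. x \<in> A \<union> B \<Longrightarrow> y \<in> A \<union> B \<Longrightarrow> d x y \<le> C"
    unfolding mbounded_alt by blast
  have "bdd_above ((\<lambda>x. set_dist x B) ` A)"
    using b C by (intro bdd_aboveI[of _ C]) (auto intro: order_trans[OF set_dist_le])
  then have "set_dist x B \<le> (SUP x\<in>A. set_dist x B)" using assms by (intro cSUP_upper)
  then show ?thesis using assms by (intro set_dist_lessD) (auto simp: Hausdorff_dist_def)
qed

lemma Hausdorff_dist_leI:
  assumes "A \<noteq> {}" "B \<noteq> {}"
    and "\<And>x. x \<in> A \<Longrightarrow> \<exists>b\<in>B. d x b \<le> e" "\<And>b. b \<in> B \<Longrightarrow> \<exists>x\<in>A. d x b \<le> e"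
  shows "0 \<le> Hausdorff_dist A B" "Hausdorff_dist A B \<le> e"
proof -
  have 1: "set_dist x B \<le> e" if "x \<in> A" for x
    using assms(3)[OF that] set_dist_le order_trans by blast
  have 2: "set_dist b A \<le> e" if "b \<in> B" for b
    using assms(4)[OF that] set_dist_le order_trans commute by metis
  show "Hausdorff_dist A B \<le> e"
    unfolding Hausdorff_dist_def using 1 2 assms by (auto intro!: cSUP_least)
  from assms obtain x where "x \<in> A" by blast
  have "0 \<le> set_dist x B" by (rule set_dist_nonneg) fact
  also have "\<dots> \<le> (SUP x\<in>A. set_dist x B)"
    using \<open>x \<in> A\<close> 1 by (intro cSUP_upper) (auto intro: bdd_aboveI[of _ e])
  finally show "0 \<le> Hausdorff_dist A B" by (simp add: Hausdorff_dist_def)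
qed

lemma dist_le_diam: "mbounded A \<Longrightarrow> x \<in> A \<Longrightarrow> y \<in> A \<Longrightarrow> d x y \<le> diam A"
proof -
  assume A: "mbounded A" "x \<in> A" "y \<in> A"
  then obtain C where "\<And>x y. x \<in> A \<Longrightarrow> y \<in> A \<Longrightarrow> d x y \<le> C" by (auto simp: mbounded_alt)
  then have "bdd_above ((\<lambda>(x, y). d x y) ` (A \<times> A))" by (intro bdd_aboveI[of _ C]) auto
  from cSUP_upper[OF _ this, of "(x, y)"] A show ?thesis by (simp add: diam_def)
qed

lemma diam_leI: "A \<noteq> {} \<Longrightarrow> (\<And>x y. x \<in> A \<Longrightarrow> y \<in> A \<Longrightarrow> d x y \<le> e) \<Longrightarrow> diam A \<le> e"
  unfolding diam_def by (rule cSUP_least) auto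

lemma diam_nonneg: "A \<noteq> {} \<Longrightarrow> mbounded A \<Longrightarrow> 0 \<le> diam A"
  using dist_le_diam nonneg order_trans by (metis ex_in_conv)

lemma Pbcl_mcball: "x \<in> M \<Longrightarrow> 0 \<le> r \<Longrightarrow> mcball x r \<in> Pbcl"
  by (auto simp: Pbcl_def mbounded_mcball mcball_eq_empty)

lemma Pbcl_closure: "B \<noteq> {} \<Longrightarrow> mbounded B \<Longrightarrow> mtopology closure_of B \<in> Pbcl"
  using closure_of_subset[of B mtopology] mbounded_subset_mspace[of B]
  by (auto simp: Pbcl_def mbounded_closure_of)

lemma subset_closure: "B \<subseteq> M \<Longrightarrow> B \<subseteq> mtopology closure_of B"
  by (simp add: closure_of_subset)

text \<open>This is the Lebesgue number lemma for a cover by one open set.\<close>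

lemma uniform_neighbourhood_of_compact:
  assumes "compactin mtopology A" "openin mtopology U" "A \<subseteq> U"
  shows "\<exists>\<delta>>0. \<forall>a\<in>A. \<forall>y\<in>M. d a y < \<delta> \<longrightarrow> y \<in> U"
proof -
  obtain \<delta> where "\<delta> > 0" "\<forall>a\<in>A. mball a \<delta> \<subseteq> U"
    using lebesgue_number[OF assms(1), of "{U}"] assms by auto
  moreover have "A \<subseteq> M" using assms(2,3) openin_subset by fastforce
  ultimately show ?thesis by (meson in_mball subset_iff)
qed

text \<open>Continuity at the points of a compact set is uniform even if only one of the two arguments is
  required to lie in the set.  For one map, take a Lebesgue number of the cover by all open sets whose
  image is \<open>\<epsilon>\<close>-small; for finitely many, the least of the numbers obtained.\<close>

lemma equicontinuous_near_compact:
  assumes "compactin mtopology A" "finite G"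
    and "\<And>g. g \<in> G \<Longrightarrow> continuous_map mtopology mtopology g" and "\<epsilon> > 0"
  shows "\<exists>\<delta>>0. \<forall>g\<in>G. \<forall>a\<in>A. \<forall>y\<in>M. d a y < \<delta> \<longrightarrow> d (g a) (g y) < \<epsilon>"
  using assms(2,3)
proof (induction G rule: finite_induct)
  case empty
  show ?case by (rule exI[of _ 1]) auto
next
  case (insert g G)
  then obtain \<delta>1 where \<delta>1: "\<delta>1 > 0" "\<forall>g\<in>G. \<forall>a\<in>A. \<forall>y\<in>M. d a y < \<delta>1 \<longrightarrow> d (g a) (g y) < \<epsilon>"
    by auto
  define \<C> where "\<C> = {U. openin mtopology U \<and> (\<forall>y\<in>U. \<forall>z\<in>U. d (g y) (g z) < \<epsilon>)}"
  have A: "A \<subseteq> M" using assms(1) compactin_subset_topspace by fastforce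
  have g: "continuous_map mtopology mtopology g" using insert.prems by simp
  have "A \<subseteq> \<Union>\<C>"
  proof
    fix a assume "a \<in> A"
    then have a: "a \<in> M" "g a \<in> M" using A g by (auto simp: continuous_map_def)
    let ?U = "{y \<in> M. g y \<in> mball (g a) (\<epsilon> / 2)}"
    have "openin mtopology ?U"
      using openin_continuous_map_preimage[OF g openin_mball, of "g a" "\<epsilon> / 2"]
      by (simp only: topspace_mtopology)
    moreover have "d (g y) (g z) < \<epsilon>" if "y \<in> ?U" "z \<in> ?U" for y z
      using that triangle''[of "g y" "g a" "g z"] by auto
    ultimately have "?U \<in> \<C>" unfolding \<C>_def by blast
    moreover have "a \<in> ?U" using a \<open>\<epsilon> > 0\<close> by simp
    ultimately show "a \<in> \<Union>\<C>" by blast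
  qed
  moreover have "openin mtopology U" if "U \<in> \<C>" for U using that by (simp add: \<C>_def)
  ultimately obtain \<delta>2 where \<delta>2: "\<delta>2 > 0" "\<forall>a\<in>A. \<exists>U\<in>\<C>. mball a \<delta>2 \<subseteq> U"
    using lebesgue_number[OF assms(1), of \<C>] by metis
  have "d (g a) (g y) < \<epsilon>" if ay: "a \<in> A" "y \<in> M" "d a y < \<delta>2" for a y
  proof -
    obtain U where U: "U \<in> \<C>" "mball a \<delta>2 \<subseteq> U"
using \<delta>2(2) ay(1) by blast
    moreover have "a \<in> mball a \<delta>2" "y \<in> mball a \<delta>2" using ay A \<delta>2(1) by auto
    ultimately show ?thesis unfolding \<C>_def by blast
  qed
  then show ?case using \<delta>1 \<delta>2(1) by (intro exI[of _ "min \<delta>1 \<delta>2"]) auto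
qed

end

section \<open>Word maps, the fractal operator and fibres\<close>

context IFS
begin

lemma f_closed: "i \<in> I \<Longrightarrow> x \<in> X \<Longrightarrow> f i x \<in> X"
  using continuous_f[of i] by (auto simp: continuous_map_def)

lemma word_map_closed: "w \<in> lists I \<Longrightarrow> x \<in> X \<Longrightarrow> word_map f w x \<in> X"
  by (induction w) (auto simp: f_closed)

lemma continuous_word_map:
  "w \<in> lists I \<Longrightarrow> continuous_map mtopology mtopology (word_map f w)"
  by (induction w) (auto simp: id_def intro: continuous_map_compose continuous_f)

lemma prefix_map_closed: "\<omega> \<in> inf_words I \<Longrightarrow> x \<in> X \<Longrightarrow> word_map f (prefix_word \<omega> n) x \<in> X"
  by (simp add: word_map_closed prefix_word_in_lists)

lemma mbounded_f_image: "i \<in> I \<Longrightarrow> mbounded B \<Longrightarrow> mbounded (f i ` B)"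
  using bounded_f[of i B] by (cases "B = {}") (auto simp: Pb_def)

lemma mbounded_word_map_image: "w \<in> lists I \<Longrightarrow> mbounded B \<Longrightarrow> mbounded (word_map f w ` B)"
proof (induction w)
  case (Cons i w)
  then show ?case
    using mbounded_f_image[of i "word_map f w ` B"] by (simp add: image_image)
qed simp

lemma mbounded_words_image:
  assumes "mbounded B"
  shows "mbounded (\<Union>w\<in>fin_words n I. word_map f w ` B)"
proof (rule mbounded_Union)
  show "finite ((\<lambda>w. word_map f w ` B) ` fin_words n I)"
    by (simp add: finite_fin_words I_finite)
  fix Y assume "Y \<in> (\<lambda>w. word_map f w ` B) ` fin_words n I"
  then show "mbounded Y" using assms mbounded_word_map_image by (auto simp: fin_words_eq)
qed

lemma fractal_operator_closure:
  assumes "S \<subseteq> X"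
  shows "fractal_operator (mtopology closure_of S) = fractal_operator S"
proof -
  have "f i ` (mtopology closure_of S) \<subseteq> mtopology closure_of (\<Union>i\<in>I. f i ` S)" if "i \<in> I" for i
  proof -
    have "f i ` (mtopology closure_of S) \<subseteq> mtopology closure_of (f i ` S)"
      using continuous_f[OF that] by (rule continuous_map_image_closure_subset)
    also have "\<dots> \<subseteq> mtopology closure_of (\<Union>i\<in>I. f i ` S)"
      using that by (intro closure_of_mono) auto
    finally show ?thesis .
  qed
  then have "fractal_operator (mtopology closure_of S) \<subseteq> fractal_operator S"
    unfolding fractal_operator_def by (intro closure_of_minimal) auto
  moreover have "fractal_operator S \<subseteq> fractal_operator (mtopology closure_of S)"
    unfolding fractal_operator_def using subset_closure[OF assms]
    by (intro closure_of_mono) auto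
  ultimately show ?thesis by blast
qed

text \<open>The closures taken at the intermediate iterations are absorbed by the last one, since the maps are
  continuous.\<close>

lemma fractal_operator_funpow:
  assumes "B \<in> Pbcl"
  shows "(fractal_operator ^^ n) B = mtopology closure_of (\<Union>w\<in>fin_words n I. word_map f w ` B)"
proof (induction n)
  case 0
  have "fin_words 0 I = {[]}" by (auto simp: fin_words_def)
  then show ?case using assms by (simp add: Pbcl_def closure_of_closedin)
next
  case (Suc n)
  let ?S = "\<lambda>n. \<Union>w\<in>fin_words n I. word_map f w ` B"
  have B: "B \<subseteq> X" using assms by (auto simp: Pbcl_def mbounded_subset_mspace)
  have S: "?S n \<subseteq> X" using B word_map_closed by (fastforce simp: fin_words_eq)
  have "(\<Union>i\<in>I. f i ` ?S n) = ?S (Suc n)"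
  proof (intro equalityI subsetI)
    fix z assume "z \<in> (\<Union>i\<in>I. f i ` ?S n)"
    then obtain i w b where "i \<in> I" "w \<in> fin_words n I" "b \<in> B" "z = f i (word_map f w b)" by blast
    then have "i # w \<in> fin_words (Suc n) I" "z = word_map f (i # w) b" by (auto simp: fin_words_def)
    then show "z \<in> ?S (Suc n)" using \<open>b \<in> B\<close> by blast
  next
    fix z assume "z \<in> ?S (Suc n)"
    then obtain w b where w: "w \<in> fin_words (Suc n) I" "b \<in> B" "z = word_map f w b" by blast
    then obtain i w' where "w = i # w'" by (cases w) (auto simp: fin_words_def)
    with w have "i \<in> I" "w' \<in> fin_words n I" "z = f i (word_map f w' b)" by (auto simp: fin_words_def)
    then show "z \<in> (\<Union>i\<in>I. f i ` ?S n)" using \<open>b \<in> B\<close> by blast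
  qed
  then show ?case
    by (simp add: Suc.IH fractal_operator_closure[OF S]) (simp add: fractal_operator_def)
qed

text \<open>The vanishing of \<^const>\<open>max_deviation\<close> in the limit, stated with real numbers and with finite words
  \<open>w\<close>: the continuations \<open>\<omega>\<close> of \<open>w\<close> range over all infinite words, so \<open>prepend_word w \<omega>\<close> ranges over
  all infinite words with prefix \<open>w\<close>.\<close>

definition uniform_fibres_on :: "'a set \<Rightarrow> bool"
  where "uniform_fibres_on D \<longleftrightarrow> (\<forall>\<epsilon>>0. \<exists>N. \<forall>w\<in>lists I. length w \<ge> N \<longrightarrow>
    (\<forall>\<omega>\<in>inf_words I. \<forall>y\<in>D. d (word_map f w y) (fibre_point (prepend_word w \<omega>)) \<le> \<epsilon>))"

lemma uniform_fibres_on_subset: "uniform_fibres_on D \<Longrightarrow> E \<subseteq> D \<Longrightarrow> uniform_fibres_on E"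
  unfolding uniform_fibres_on_def by (meson subsetD)

lemma uniform_fibres_on_prefix:
  assumes "uniform_fibres_on D" "\<epsilon> > 0"
  obtains N where "\<And>n \<omega> y. n \<ge> N \<Longrightarrow> \<omega> \<in> inf_words I \<Longrightarrow> y \<in> D \<Longrightarrow>
    d (word_map f (prefix_word \<omega> n) y) (fibre_point \<omega>) \<le> \<epsilon>"
proof -
  obtain N where N: "\<And>w \<omega> y. w \<in> lists I \<Longrightarrow> N \<le> length w \<Longrightarrow> \<omega> \<in> inf_words I \<Longrightarrow> y \<in> D \<Longrightarrow>
      d (word_map f w y) (fibre_point (prepend_word w \<omega>)) \<le> \<epsilon>"
    using assms unfolding uniform_fibres_on_def by meson
  show ?thesis
  proof (rule that)
    fix n \<omega> y assume *: "n \<ge> N" "\<omega> \<in> inf_words I" "y \<in> D"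
    have "d (word_map f (prefix_word \<omega> n) y)
        (fibre_point (prepend_word (prefix_word \<omega> n) (\<lambda>k. \<omega> (n + k)))) \<le> \<epsilon>"
      by (rule N) (use * prefix_word_in_lists[of \<omega> I n] shifted_inf_words[of \<omega> I n] in simp_all)
    then show "d (word_map f (prefix_word \<omega> n) y) (fibre_point \<omega>) \<le> \<epsilon>"
      by (simp only: prepend_prefix_word)
  qed
qed

lemma uniform_fibres_on_prefixI:
  assumes "\<And>\<epsilon>. \<epsilon> > 0 \<Longrightarrow> \<exists>N. \<forall>n\<ge>N. \<forall>\<omega>\<in>inf_words I. \<forall>y\<in>D.
    d (word_map f (prefix_word \<omega> n) y) (fibre_point \<omega>) \<le> \<epsilon>"
  shows "uniform_fibres_on D"
  unfolding uniform_fibres_on_def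
proof (intro allI impI)
  fix \<epsilon> :: real assume "\<epsilon> > 0"
  then obtain N where N: "\<And>n \<omega> y. n \<ge> N \<Longrightarrow> \<omega> \<in> inf_words I \<Longrightarrow> y \<in> D \<Longrightarrow>
    d (word_map f (prefix_word \<omega> n) y) (fibre_point \<omega>) \<le> \<epsilon>" using assms by meson
  have "d (word_map f w y) (fibre_point (prepend_word w \<omega>)) \<le> \<epsilon>"
    if "w \<in> lists I" "N \<le> length w" "\<omega> \<in> inf_words I" "y \<in> D" for w \<omega> y
    using N[of "length w" "prepend_word w \<omega>" y] prepend_word_inf_words[of w I \<omega>]
      prefix_prepend_word[of w "length w" \<omega>] that by simp
  then show "\<exists>N. \<forall>w\<in>lists I. length w \<ge> N \<longrightarrow>
    (\<forall>\<omega>\<in>inf_words I. \<forall>y\<in>D. d (word_map f w y) (fibre_point (prepend_word w \<omega>)) \<le> \<epsilon>)"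
    by blast
qed

lemma max_deviation_tendsto_0_iff: "max_deviation D \<longlonglongrightarrow> 0 \<longleftrightarrow> uniform_fibres_on D"
proof
  assume lim: "max_deviation D \<longlonglongrightarrow> 0"
  show "uniform_fibres_on D"
  proof (rule uniform_fibres_on_prefixI)
    fix \<epsilon> :: real assume "\<epsilon> > 0"
    then have "\<forall>\<^sub>F n in sequentially. max_deviation D n < ennreal \<epsilon>"
      using order_tendstoD(2)[OF lim, of "ennreal \<epsilon>"] by (simp add: ennreal_less_zero_iff)
    then obtain N where N: "\<And>n. n \<ge> N \<Longrightarrow> max_deviation D n < ennreal \<epsilon>"
      by (auto simp: eventually_sequentially)
    have "d (word_map f (prefix_word \<omega> n) y) (fibre_point \<omega>) \<le> \<epsilon>"
      if "n \<ge> N" "\<omega> \<in> inf_words I" "y \<in> D" for n \<omega> y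
    proof -
      have "ennreal (d (word_map f (prefix_word \<omega> n) y) (fibre_point \<omega>)) \<le> max_deviation D n"
        unfolding max_deviation_def using that by (intro SUP_upper2[of \<omega>] SUP_upper)
      also have "\<dots> < ennreal \<epsilon>" using N that by blast
      finally show ?thesis using \<open>\<epsilon> > 0\<close> by (simp add: ennreal_less_iff)
    qed
    then show "\<exists>N. \<forall>n\<ge>N. \<forall>\<omega>\<in>inf_words I. \<forall>y\<in>D.
      d (word_map f (prefix_word \<omega> n) y) (fibre_point \<omega>) \<le> \<epsilon>" by blast
  qed
next
  assume U: "uniform_fibres_on D"
  show "max_deviation D \<longlonglongrightarrow> 0"
  proof (rule order_tendstoI)
    fix a :: ennreal assume "0 < a"
    then obtain b where b: "0 < b" "b < a" using dense by blast
    have "b < top" using b(2) by (rule order.strict_trans2) simp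
    then have fin: "b = ennreal (enn2real b)" by simp
    have "enn2real b > 0" using b(1) \<open>b < top\<close> by (simp add: enn2real_positive_iff)
    then obtain N where N: "\<And>n \<omega> y. n \<ge> N \<Longrightarrow> \<omega> \<in> inf_words I \<Longrightarrow> y \<in> D \<Longrightarrow>
        d (word_map f (prefix_word \<omega> n) y) (fibre_point \<omega>) \<le> enn2real b"
      using uniform_fibres_on_prefix[OF U] by blast
    have "max_deviation D n \<le> b" if "n \<ge> N" for n
      unfolding max_deviation_def
      by (subst fin) (intro SUP_least ennreal_leI N that)
    then show "\<forall>\<^sub>F n in sequentially. max_deviation D n < a"
      unfolding eventually_sequentially using b by (meson le_less_trans)
  qed simp
qed

lemma uniformly_point_fibred_iff:
  "uniformly_point_fibred \<longleftrightarrow> point_fibred \<and> (\<forall>B. mbounded B \<longrightarrow> uniform_fibres_on B)"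
proof -
  have "uniform_fibres_on B" if "\<forall>B\<in>Pbcl. uniform_fibres_on B" "mbounded B" for B
  proof (cases "B = {}")
    case False
    then have "uniform_fibres_on (mtopology closure_of B)" using that Pbcl_closure by blast
    then show ?thesis
      using subset_closure[of B] that mbounded_subset_mspace uniform_fibres_on_subset by blast
  qed (simp add: uniform_fibres_on_def)
  then show ?thesis
    unfolding uniformly_point_fibred_def max_deviation_tendsto_0_iff by (auto simp: Pbcl_def)
qed

lemma fibre_point_eqI: "fibre_limit \<omega> a \<Longrightarrow> fibre_point \<omega> = a"
  unfolding fibre_point_def using fibre_limit_unique by blast

lemma fibre_point_closed: "point_fibred \<Longrightarrow> \<omega> \<in> inf_words I \<Longrightarrow> fibre_point \<omega> \<in> X"
  using fibre_limit_fibre_point by (auto simp: fibre_limit_def)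

lemma uniform_fibres_on_Union:
  assumes "finite \<D>" "\<And>D. D \<in> \<D> \<Longrightarrow> uniform_fibres_on D"
  shows "uniform_fibres_on (\<Union>\<D>)"
  using assms
proof (induction \<D> rule: finite_induct)
  case (insert D \<D>)
  have "uniform_fibres_on (D \<union> \<Union>\<D>)"
    unfolding uniform_fibres_on_def
  proof (intro allI impI)
    fix \<epsilon> :: real assume \<epsilon>: "\<epsilon> > 0"
    have 1: "uniform_fibres_on D" "uniform_fibres_on (\<Union>\<D>)" using insert by auto
    obtain N where N: "\<And>w \<omega> y. w \<in> lists I \<Longrightarrow> N \<le> length w \<Longrightarrow> \<omega> \<in> inf_words I \<Longrightarrow> y \<in> D \<Longrightarrow>
      d (word_map f w y) (fibre_point (prepend_word w \<omega>)) \<le> \<epsilon>"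
      using 1(1) \<epsilon> unfolding uniform_fibres_on_def by meson
    obtain N' where N': "\<And>w \<omega> y. w \<in> lists I \<Longrightarrow> N' \<le> length w \<Longrightarrow> \<omega> \<in> inf_words I \<Longrightarrow> y \<in> \<Union>\<D> \<Longrightarrow>
      d (word_map f w y) (fibre_point (prepend_word w \<omega>)) \<le> \<epsilon>"
      using 1(2) \<epsilon> unfolding uniform_fibres_on_def by meson
    show "\<exists>N. \<forall>w\<in>lists I. length w \<ge> N \<longrightarrow> (\<forall>\<omega>\<in>inf_words I. \<forall>y\<in>D \<union> \<Union>\<D>.
        d (word_map f w y) (fibre_point (prepend_word w \<omega>)) \<le> \<epsilon>)"
    proof (intro exI[of _ "max N N'"] ballI impI)
      fix w \<omega> y assume *: "w \<in> lists I" "max N N' \<le> length w" "\<omega> \<in> inf_words I" "y \<in> D \<union> \<Union>\<D>"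
      show "d (word_map f w y) (fibre_point (prepend_word w \<omega>)) \<le> \<epsilon>"
        using N[OF *(1) _ *(3), of y] N'[OF *(1) _ *(3), of y] *(2,4) by auto
    qed
  qed
  then show ?case by simp
qed (simp add: uniform_fibres_on_def)

text \<open>Uniform contraction in the form in which both the largest diameter of the images \<open>f\<^sub>w D\<close> and the
  new metrics below see it, that is, without fibre points.\<close>

definition shrinks_on :: "'a set \<Rightarrow> bool"
  where "shrinks_on D \<longleftrightarrow> (\<forall>\<epsilon>>0. \<exists>N. \<forall>w\<in>lists I. length w \<ge> N \<longrightarrow>
    (\<forall>x\<in>D. \<forall>y\<in>D. d (word_map f w x) (word_map f w y) \<le> \<epsilon>))"

lemma uniform_fibres_on_imp_shrinks_on:
  assumes pf: "point_fibred" and U: "uniform_fibres_on D" and D: "D \<subseteq> X"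
  shows "shrinks_on D"
  unfolding shrinks_on_def
proof (intro allI impI)
  fix \<epsilon> :: real assume "\<epsilon> > 0"
  obtain \<omega> where \<omega>: "\<omega> \<in> inf_words I" using extend_to_inf_word[of "[]" I] I_nonempty by auto
  obtain N where N: "\<And>w y. w \<in> lists I \<Longrightarrow> length w \<ge> N \<Longrightarrow> y \<in> D \<Longrightarrow>
      d (word_map f w y) (fibre_point (prepend_word w \<omega>)) \<le> \<epsilon> / 2"
    using U \<open>\<epsilon> > 0\<close> \<omega> unfolding uniform_fibres_on_def by (meson half_gt_zero)
  have "d (word_map f w x) (word_map f w y) \<le> \<epsilon>"
    if w: "w \<in> lists I" "length w \<ge> N" "x \<in> D" "y \<in> D" for w x y
  proof -
    have "fibre_point (prepend_word w \<omega>) \<in> X" "word_map f w x \<in> X" "word_map f w y \<in> X"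
      using w D \<omega> by (auto intro!: word_map_closed fibre_point_closed[OF pf] prepend_word_inf_words)
    then show ?thesis
      using triangle'[of "word_map f w x" "fibre_point (prepend_word w \<omega>)" "word_map f w y"]
        N[OF w(1,2,3)] N[OF w(1,2,4)] by simp
  qed
  then show "\<exists>N. \<forall>w\<in>lists I. length w \<ge> N \<longrightarrow>
    (\<forall>x\<in>D. \<forall>y\<in>D. d (word_map f w x) (word_map f w y) \<le> \<epsilon>)" by blast
qed

end

section \<open>Contractive systems are uniformly point fibred\<close>

text \<open>The iterates decrease to some \<open>L\<close>.  If \<open>L\<close> were positive, right-continuity at \<open>L\<close> and \<open>\<phi> L < L\<close>
  would push some iterate below \<open>L\<close>.\<close>

lemma comparison_function_funpow_tendsto:
  assumes \<phi>: "comparison_function \<phi>" and "0 \<le> t"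
  shows "(\<lambda>n. (\<phi> ^^ n) t) \<longlonglongrightarrow> 0"
proof -
  define a where "a n = (\<phi> ^^ n) t" for n
  have a_Suc: "a (Suc n) = \<phi> (a n)" for n by (simp add: a_def)
  have a_nonneg: "0 \<le> a n" for n
    by (induction n) (use \<phi> \<open>0 \<le> t\<close> in \<open>auto simp: a_def comparison_function_def\<close>)
  have \<phi>_le: "\<phi> s \<le> s" if "0 \<le> s" for s
  proof (cases "s = 0")
    case True
    have "\<phi> 0 \<le> e" if "e > 0" for e
    proof -
      have "\<phi> 0 \<le> \<phi> e" using \<phi> that by (auto simp: comparison_function_def mono_on_def)
      also have "\<dots> < e" using \<phi> that by (auto simp: comparison_function_def)
      finally show ?thesis by simp
    qed
    then show ?thesis using True by (metis field_le_epsilon add_0)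
  qed (use \<phi> that in \<open>auto simp: comparison_function_def less_imp_le\<close>)
  have "decseq a" by (rule decseq_SucI) (simp add: a_Suc \<phi>_le a_nonneg)
  then obtain L where L: "a \<longlonglongrightarrow> L" "\<And>n. L \<le> a n"
    using decseq_convergent[of a 0] a_nonneg by auto
  have "L \<ge> 0" using L(1) a_nonneg by (intro LIMSEQ_le_const) auto
  moreover have "\<not> L > 0"
  proof
    assume "L > 0"
    then have "\<phi> L < L" and "(\<phi> \<longlongrightarrow> \<phi> L) (at_right L)"
      using \<phi> by (auto simp: comparison_function_def continuous_within)
    then have "\<forall>\<^sub>F s in at_right L. \<phi> s < L" by (rule order_tendstoD(2)[rotated])
    then obtain b where b: "b > L" "\<And>s. L < s \<Longrightarrow> s < b \<Longrightarrow> \<phi> s < L"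
      unfolding eventually_at_right_field by auto
    have "\<forall>\<^sub>F n in sequentially. a n < b" using order_tendstoD(2)[OF L(1) b(1)] .
    then obtain n where "a n < b" by (auto simp: eventually_sequentially)
    then have "\<phi> (a n) < L" using b(2)[of "a n"] L(2)[of n] \<open>\<phi> L < L\<close> by (cases "a n = L") auto
    then show False using L(2)[of "Suc n"] by (simp add: a_Suc)
  qed
  ultimately have "L = 0" by simp
  with L show ?thesis by (simp add: a_def[abs_def])
qed

context IFS
begin

text \<open>A Cauchy criterion.  It ranges over finite words and needs no candidates for the
  fibre points; these arise from completeness, and the bound for \<open>u\<close> and all its extensions \<open>u @ v\<close>
  passes to the limit.\<close>

lemma uniformly_point_fibredI:
  assumes "\<And>B \<epsilon>. mbounded B \<Longrightarrow> \<epsilon> > 0 \<Longrightarrow> \<exists>N. \<forall>u\<in>lists I. \<forall>v\<in>lists I. length u \<ge> N \<longrightarrow>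
    (\<forall>x\<in>B. \<forall>y\<in>B. d (word_map f u x) (word_map f (u @ v) y) \<le> \<epsilon>)"
  shows "uniformly_point_fibred"
proof -
  have prefixes: "\<exists>N. \<forall>n\<ge>N. \<forall>m\<ge>n. \<forall>\<omega>\<in>inf_words I. \<forall>x\<in>B. \<forall>y\<in>B.
      d (word_map f (prefix_word \<omega> n) x) (word_map f (prefix_word \<omega> m) y) \<le> \<epsilon>"
    if B: "mbounded B" and "\<epsilon> > 0" for B \<epsilon>
  proof -
    obtain N where N: "\<And>u v x y. u \<in> lists I \<Longrightarrow> v \<in> lists I \<Longrightarrow> length u \<ge> N \<Longrightarrow> x \<in> B \<Longrightarrow>
        y \<in> B \<Longrightarrow> d (word_map f u x) (word_map f (u @ v) y) \<le> \<epsilon>"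
      using assms[OF B \<open>\<epsilon> > 0\<close>] by blast
    have "d (word_map f (prefix_word \<omega> n) x) (word_map f (prefix_word \<omega> m) y) \<le> \<epsilon>"
      if "n \<ge> N" "m \<ge> n" "\<omega> \<in> inf_words I" "x \<in> B" "y \<in> B" for n m \<omega> x y
    proof -
      have "prefix_word \<omega> m = prefix_word \<omega> n @ prefix_word (\<lambda>k. \<omega> (n + k)) (m - n)"
        using prefix_word_add[of \<omega> n "m - n"] that by simp
      then show ?thesis
        using N[OF prefix_word_in_lists[of \<omega> I n]
            prefix_word_in_lists[OF shifted_inf_words[of \<omega> I n]]] that by simp
    qed
    then show ?thesis by blast
  qed
  have limit: "\<exists>a. fibre_limit \<omega> a" if \<omega>: "\<omega> \<in> inf_words I" for \<omega>
  proof -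
    let ?s = "\<lambda>x n. word_map f (prefix_word \<omega> n) x"
    from X_nonempty obtain x0 where x0: "x0 \<in> X" by blast
    have "MCauchy (?s x0)"
      unfolding MCauchy_def
    proof (intro conjI allI impI)
      show "range (?s x0) \<subseteq> X" using prefix_map_closed[OF \<omega> x0] by blast
      fix \<epsilon> :: real assume "\<epsilon> > 0"
      obtain N where "\<And>n m. n \<ge> N \<Longrightarrow> m \<ge> n \<Longrightarrow> d (?s x0 n) (?s x0 m) \<le> \<epsilon> / 2"
        using prefixes[of "{x0}" "\<epsilon> / 2"] x0 \<open>\<epsilon> > 0\<close> \<omega> by (auto simp: mbounded_insert)
      then have "d (?s x0 n) (?s x0 m) \<le> \<epsilon> / 2" if "n \<ge> N" "m \<ge> N" for n m
        using that commute by (metis nle_le)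
      then show "\<exists>N. \<forall>n n'. N \<le> n \<longrightarrow> N \<le> n' \<longrightarrow> d (?s x0 n) (?s x0 n') < \<epsilon>"
        using \<open>\<epsilon> > 0\<close> by (metis field_sum_of_halves le_less_trans less_add_same_cancel1 half_gt_zero)
    qed
    then obtain a where a: "limitin mtopology (?s x0) a sequentially"
      using complete unfolding mcomplete_def by blast
    have "limitin mtopology (?s x) a sequentially" if x: "x \<in> X" for x
      unfolding limit_metric_sequentially
    proof (intro conjI allI impI)
      show aX: "a \<in> X" using a limitin_mspace by blast
      fix \<epsilon> :: real assume "\<epsilon> > 0"
      obtain N1 where N1: "\<And>n. n \<ge> N1 \<Longrightarrow> d (?s x0 n) a < \<epsilon> / 2"
        using a \<open>\<epsilon> > 0\<close> unfolding limit_metric_sequentially by (metis half_gt_zero)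
      obtain N2 where N2: "\<And>n. n \<ge> N2 \<Longrightarrow> d (?s x n) (?s x0 n) \<le> \<epsilon> / 2"
        using prefixes[of "{x, x0}" "\<epsilon> / 2"] x x0 \<open>\<epsilon> > 0\<close> \<omega> by (fastforce simp: mbounded_insert)
      have "?s x n \<in> X \<and> d (?s x n) a < \<epsilon>" if "n \<ge> max N1 N2" for n
        using N1[of n] N2[of n] that
          triangle[of "?s x n" "?s x0 n" a] prefix_map_closed[OF \<omega>] x x0 aX by auto
      then show "\<exists>N. \<forall>n\<ge>N. ?s x n \<in> X \<and> d (?s x n) a < \<epsilon>" by blast
    qed
    then show ?thesis using a limitin_mspace unfolding fibre_limit_def by blast
  qed
  then have pf: "point_fibred" by (simp add: point_fibred_def)
  have "uniform_fibres_on B" if B: "mbounded B" for B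
  proof (rule uniform_fibres_on_prefixI)
    fix \<epsilon> :: real assume "\<epsilon> > 0"
    then obtain N where N: "\<And>n m \<omega> x y. n \<ge> N \<Longrightarrow> m \<ge> n \<Longrightarrow> \<omega> \<in> inf_words I \<Longrightarrow> x \<in> B \<Longrightarrow> y \<in> B \<Longrightarrow>
        d (word_map f (prefix_word \<omega> n) x) (word_map f (prefix_word \<omega> m) y) \<le> \<epsilon> / 2"
      using prefixes[OF B, of "\<epsilon> / 2"] by (meson half_gt_zero)
    have "d (word_map f (prefix_word \<omega> n) y) (fibre_point \<omega>) \<le> \<epsilon>"
      if n: "n \<ge> N" and \<omega>: "\<omega> \<in> inf_words I" and y: "y \<in> B" for n \<omega> y
    proof -
      have yX: "y \<in> X" using y B mbounded_subset_mspace by blast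
      have lim: "limitin mtopology (\<lambda>m. word_map f (prefix_word \<omega> m) y) (fibre_point \<omega>) sequentially"
        using fibre_limit_fibre_point[OF pf \<omega>] yX unfolding fibre_limit_def by blast
      then obtain N' where N': "\<And>m. m \<ge> N' \<Longrightarrow> d (word_map f (prefix_word \<omega> m) y) (fibre_point \<omega>) < \<epsilon> / 2"
        unfolding limit_metric_sequentially using \<open>\<epsilon> > 0\<close> by (metis half_gt_zero)
      define m where "m = max n N'"
      have "d (word_map f (prefix_word \<omega> n) y) (word_map f (prefix_word \<omega> m) y) \<le> \<epsilon> / 2"
        "d (word_map f (prefix_word \<omega> m) y) (fibre_point \<omega>) < \<epsilon> / 2"
        using N[of n m \<omega> y y] N'[of m] n \<omega> y by (auto simp: m_def)
      then show ?thesis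
        using triangle[OF prefix_map_closed[OF \<omega> yX, of n] prefix_map_closed[OF \<omega> yX, of m]
            fibre_point_closed[OF pf \<omega>]] by simp
    qed
    then show "\<exists>N. \<forall>n\<ge>N. \<forall>\<omega>\<in>inf_words I. \<forall>y\<in>B.
        d (word_map f (prefix_word \<omega> n) y) (fibre_point \<omega>) \<le> \<epsilon>" by blast
  qed
  with pf show ?thesis by (simp add: uniformly_point_fibred_iff)
qed

lemma phi_contractive_word_map:
  assumes "comparison_function \<phi>" "phi_contractive \<phi>" "w \<in> lists I" "x \<in> X" "y \<in> X"
    and "d x y \<le> r"
  shows "d (word_map f w x) (word_map f w y) \<le> (\<phi> ^^ length w) r"
  using assms(3)
proof (induction w)
  case (Cons i w)
  then have *: "word_map f w x \<in> X" "word_map f w y \<in> X" "i \<in> I"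
    using assms word_map_closed by (simp_all)
  have "d (f i (word_map f w x)) (f i (word_map f w y)) \<le> \<phi> (d (word_map f w x) (word_map f w y))"
    using assms(2) * unfolding phi_contractive_def by blast
  also have "\<dots> \<le> \<phi> ((\<phi> ^^ length w) r)"
  proof -
    have IH: "d (word_map f w x) (word_map f w y) \<le> (\<phi> ^^ length w) r" using Cons by simp
    moreover have "0 \<le> (\<phi> ^^ length w) r" using IH nonneg order_trans by blast
    ultimately show ?thesis
      using assms(1) unfolding comparison_function_def mono_on_def by auto
  qed
  finally show ?case by simp
qed (use assms in simp)

text \<open>The classical proof that the orbit of a single \<open>\<phi>\<close>-contraction is Cauchy uses that a small ball
  around a late iterate is mapped into itself.  Here the words grow at the inner end, and the
  corresponding statement compares \<open>f\<^sub>u x\<^sub>0\<close> with the image of \<open>x\<^sub>0\<close> under the prefix of \<open>u\<close> of a fixed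
  length \<open>k\<close>.\<close>

lemma phi_contractive_imp_uniformly_point_fibred:
  assumes \<phi>: "comparison_function \<phi>" "phi_contractive \<phi>"
  shows "uniformly_point_fibred"
proof (rule uniformly_point_fibredI)
  fix B and \<epsilon> :: real assume B: "mbounded B" and "\<epsilon> > 0"
  from X_nonempty obtain x0 where x0: "x0 \<in> X" by blast
  define D where "D = Max ((\<lambda>i. d x0 (f i x0)) ` I)"
  have D: "d x0 (f i x0) \<le> D" if "i \<in> I" for i
    unfolding D_def using that I_finite by (intro Max_ge) auto
  have D0: "0 \<le> D" using D I_nonempty nonneg order_trans by blast
  \<comment> \<open>The final estimate passes through three intermediate points, which costs \<open>4 * \<eta>\<close>.\<close>
  define \<eta> where "\<eta> = \<epsilon> / 4"
  have \<eta>: "\<eta> > 0" using \<open>\<epsilon> > 0\<close> by (simp add: \<eta>_def)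
  then have "\<eta> - \<phi> \<eta> > 0" using \<phi>(1) by (simp add: comparison_function_def)
  then have "\<forall>\<^sub>F k in sequentially. (\<phi> ^^ k) D < \<eta> - \<phi> \<eta>"
    using order_tendstoD(2)[OF comparison_function_funpow_tendsto[OF \<phi>(1) D0]] by blast
  then obtain k where k: "(\<phi> ^^ k) D \<le> \<eta> - \<phi> \<eta>"
    by (meson eventually_happens' less_imp_le sequentially_bot)
  \<comment> \<open>Inductive step for \<open>i # u\<close>: applying \<open>f i\<close> to the induction hypothesis costs \<open>\<phi> \<eta>\<close> and arrives at
    the word \<open>i # take k u\<close>, which is one letter too long; dropping its last letter \<open>j\<close> moves the
    innermost point by at most \<open>D\<close>, hence the image by at most \<open>\<phi>\<^sup>k D \<le> \<eta> - \<phi> \<eta>\<close>.\<close>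
  have near: "d (word_map f u x0) (word_map f (take k u) x0) \<le> \<eta>" if "u \<in> lists I" "k \<le> length u" for u
    using that
  proof (induction u rule: list.induct)
    case Nil
    then show ?case using x0 \<eta> by simp
  next
    case (Cons i u)
    show ?case
    proof (cases "k \<le> length u")
      case True
      let ?v = "take k u"
      have sub: "set (i # u) \<subseteq> I" using Cons.prems(1) by (simp only: in_lists_conv_set) blast
      then have v: "?v \<in> lists I" "u \<in> lists I" "i \<in> I"
        using set_take_subset[of k u] by (auto simp: in_lists_conv_set)
      have "d (word_map f u x0) (word_map f ?v x0) \<le> \<eta>" using Cons True by auto
      then have "\<phi> (d (word_map f u x0) (word_map f ?v x0)) \<le> \<phi> \<eta>"
        using \<phi>(1) \<eta> by (auto simp: comparison_function_def mono_on_def)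
      then have 1: "d (word_map f (i # u) x0) (word_map f (i # ?v) x0) \<le> \<phi> \<eta>"
        using \<phi>(2)[unfolded phi_contractive_def, rule_format,
            OF v(3) word_map_closed[OF v(2) x0] word_map_closed[OF v(1) x0]] by simp
      have iv: "i # ?v = take k (i # ?v) @ drop k (i # ?v)" by simp
      have "length (drop k (i # ?v)) = Suc 0" using True by simp
      then obtain j where j: "drop k (i # ?v) = [j]" by (auto simp only: length_Suc_conv length_0_conv)
      have jI: "j \<in> I"
      proof -
        have "j \<in> set (i # ?v)" using j by (metis in_set_dropD list.set_intros(1))
        then show ?thesis using v by auto
      qed
      have tk: "take k (i # ?v) = take k (i # u)" "take k (i # u) \<in> lists I" "length (take k (i # u)) = k"
      proof -
        show "take k (i # ?v) = take k (i # u)" by (cases k) (simp_all add: min_def)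
        show "take k (i # u) \<in> lists I"
          using sub set_take_subset[of k "i # u"] by (auto simp only: in_lists_conv_set)
      qed (use True in simp)
      have "i # ?v = take k (i # u) @ [j]" using iv j tk by simp
      then have "word_map f (i # ?v) x0 = word_map f (take k (i # u)) (f j x0)"
        by (simp only: word_map_append) simp
      moreover have "d (word_map f (take k (i # u)) (f j x0)) (word_map f (take k (i # u)) x0) \<le> (\<phi> ^^ k) D"
        using phi_contractive_word_map[OF \<phi> tk(2), of "f j x0" x0 D] D[OF jI] x0 f_closed jI tk(3)
        by (simp add: commute)
      ultimately have "d (word_map f (i # ?v) x0) (word_map f (take k (i # u)) x0) \<le> \<eta> - \<phi> \<eta>"
        using k by simp
      moreover have "d (word_map f (i # u) x0) (word_map f (take k (i # u)) x0)
          \<le> d (word_map f (i # u) x0) (word_map f (i # ?v) x0)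
            + d (word_map f (i # ?v) x0) (word_map f (take k (i # u)) x0)"
        using v tk(2) x0 by (intro triangle word_map_closed) auto
      ultimately show ?thesis using 1 by simp
    next
      case False
      then have "take k (i # u) = i # u" using Cons.prems by simp
      then show ?thesis
        using mdist_zero[OF word_map_closed[OF Cons.prems(1) x0]] \<eta> by simp
    qed
  qed
  from B obtain r where r: "r \<ge> 0" "\<And>x. x \<in> B \<Longrightarrow> d x x0 \<le> r"
  proof -
    from B have "mbounded (insert x0 B)" using x0 by (simp add: mbounded_insert)
    then obtain r where "\<forall>x\<in>insert x0 B. \<forall>y\<in>insert x0 B. d x y \<le> r" unfolding mbounded_alt by blast
    then show thesis using that[of "max r 0"] by (auto simp: max.coboundedI1)
  qed
  have "\<forall>\<^sub>F n in sequentially. (\<phi> ^^ n) r < \<eta>"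
    using order_tendstoD(2)[OF comparison_function_funpow_tendsto[OF \<phi>(1) r(1)] \<eta>] .
  then obtain N where N: "\<And>n. n \<ge> N \<Longrightarrow> (\<phi> ^^ n) r < \<eta>" by (auto simp: eventually_sequentially)
  have shrink: "d (word_map f u x) (word_map f u x0) \<le> \<eta>" if "u \<in> lists I" "length u \<ge> N" "x \<in> B" for u x
    using phi_contractive_word_map[OF \<phi> that(1) _ x0, of x r] r(2)[OF that(3)] N[OF that(2)]
      mbounded_subset_mspace[OF B] that by auto
  have "d (word_map f u x) (word_map f (u @ v) y) \<le> \<epsilon>"
    if u: "u \<in> lists I" "v \<in> lists I" "length u \<ge> max N k" "x \<in> B" "y \<in> B" for u v x y
  proof -
    have uv: "u @ v \<in> lists I" using u by simp
    have t: "take k u \<in> lists I" using u by (auto dest: in_set_takeD)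
    have X: "x \<in> X" "y \<in> X" using u mbounded_subset_mspace[OF B] by auto
    note c = word_map_closed[OF u(1) X(1)] word_map_closed[OF u(1) x0] word_map_closed[OF t x0]
      word_map_closed[OF uv x0] word_map_closed[OF uv X(2)]
    have "d (word_map f u x) (word_map f u x0) \<le> \<eta>" using shrink u by simp
    moreover have "d (word_map f u x0) (word_map f (take k u) x0) \<le> \<eta>" using near u by simp
    moreover have "d (word_map f (take k u) x0) (word_map f (u @ v) x0) \<le> \<eta>"
      using near[OF uv] u by (simp add: commute)
    moreover have "d (word_map f (u @ v) x0) (word_map f (u @ v) y) \<le> \<eta>"
      using shrink[OF uv _ u(5)] u by (simp add: commute)
    ultimately show ?thesis
      using triangle[OF c(1,2,5)] triangle[OF c(2,3,5)] triangle[OF c(3,4,5)] \<eta>_def by linarith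
  qed
  then show "\<exists>N. \<forall>u\<in>lists I. \<forall>v\<in>lists I. length u \<ge> N \<longrightarrow>
    (\<forall>x\<in>B. \<forall>y\<in>B. d (word_map f u x) (word_map f (u @ v) y) \<le> \<epsilon>)" by blast
qed

end

section \<open>Fibre sets, diameters and attractors\<close>

context IFS
begin

lemma fibre_point_shift_in:
  assumes pf: "point_fibred" and i: "i \<in> I" and \<omega>: "\<omega> \<in> inf_words I"
  shows "f i (fibre_point \<omega>) = fibre_point (shift_in i \<omega>)"
proof -
  from X_nonempty obtain x where x: "x \<in> X" by blast
  have "limitin mtopology (\<lambda>n. word_map f (prefix_word \<omega> n) x) (fibre_point \<omega>) sequentially"
    using fibre_limit_fibre_point[OF pf \<omega>] x by (simp add: fibre_limit_def)
  then have "limitin mtopology (f i \<circ> (\<lambda>n. word_map f (prefix_word \<omega> n) x)) (f i (fibre_point \<omega>)) sequentially"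
    by (rule continuous_map_limit[OF continuous_f[OF i]])
  then have "limitin mtopology (\<lambda>n. word_map f (prefix_word (shift_in i \<omega>) (Suc n)) x)
      (f i (fibre_point \<omega>)) sequentially"
    by (simp add: prefix_word_shift_in comp_def)
  moreover have "limitin mtopology (\<lambda>n. word_map f (prefix_word (shift_in i \<omega>) (Suc n)) x)
      (fibre_point (shift_in i \<omega>)) sequentially"
  proof -
    have "limitin mtopology (\<lambda>n. word_map f (prefix_word (shift_in i \<omega>) n) x)
        (fibre_point (shift_in i \<omega>)) sequentially"
      using fibre_limit_fibre_point[OF pf shift_in_inf_words[OF i \<omega>]] x by (simp add: fibre_limit_def)
    from limitin_sequentially_offset[OF this, of 1] show ?thesis by simp
  qed
  ultimately show ?thesis by (metis limitin_metric_unique trivial_limit_sequentially)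
qed

text \<open>Under a map \<open>\<pi>\<close> intertwining the shifts with the maps \<open>f i\<close>, the image \<open>f\<^sub>w (\<pi> ` \<Lambda>)\<close> is the
  \<open>\<pi>\<close>-image of the cylinder of words with prefix \<open>w\<close>.\<close>

lemma conjugation_prepend_word:
  assumes "\<And>i \<omega>. i \<in> I \<Longrightarrow> \<omega> \<in> inf_words I \<Longrightarrow> f i (\<pi> \<omega>) = \<pi> (shift_in i \<omega>)"
    and "w \<in> lists I" "\<omega> \<in> inf_words I"
  shows "word_map f w (\<pi> \<omega>) = \<pi> (prepend_word w \<omega>)"
  using assms(2)
proof (induction w)
  case (Cons i w)
  then show ?case using assms(1)[OF Cons.hyps(1) prepend_word_inf_words[OF Cons.hyps(2) assms(3)]] by simp
qed simp

text \<open>Two words with the same prefix of length \<open>n\<close> send \<open>x\<close> to the same point after \<open>n\<close> maps, and this point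
  is close to both fibre points; uniformity over one single point \<open>x\<close> therefore suffices.\<close>

lemma continuous_fibre_point:
  assumes pf: "point_fibred" and x: "x \<in> X" and U: "uniform_fibres_on {x}"
  shows "continuous_map (Metric_space.mtopology (inf_words I) word_dist) mtopology fibre_point"
proof -
  interpret W: Metric_space "inf_words I" word_dist by (rule Metric_space_words)
  have "\<exists>\<delta>>0. \<forall>\<theta>. \<theta> \<in> inf_words I \<and> word_dist \<omega> \<theta> < \<delta> \<longrightarrow> d (fibre_point \<omega>) (fibre_point \<theta>) < \<epsilon>"
    if \<omega>: "\<omega> \<in> inf_words I" and "\<epsilon> > 0" for \<omega> \<epsilon>
  proof -
    obtain n where n: "\<And>\<omega>. \<omega> \<in> inf_words I \<Longrightarrow>
        d (word_map f (prefix_word \<omega> n) x) (fibre_point \<omega>) \<le> \<epsilon> / 3"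
      using uniform_fibres_on_prefix[OF U, of "\<epsilon> / 3"] \<open>\<epsilon> > 0\<close>
      by (metis order_refl singletonI zero_less_divide_iff zero_less_numeral)
    have "d (fibre_point \<omega>) (fibre_point \<theta>) < \<epsilon>"
      if \<theta>: "\<theta> \<in> inf_words I" and "word_dist \<omega> \<theta> < (1 / 2) ^ Suc n" for \<theta>
    proof -
      have "prefix_word \<omega> n = prefix_word \<theta> n"
        using that(2) word_dist_le_iff by (meson less_imp_le)
      then have "d (word_map f (prefix_word \<omega> n) x) (fibre_point \<omega>) \<le> \<epsilon> / 3"
        "d (word_map f (prefix_word \<omega> n) x) (fibre_point \<theta>) \<le> \<epsilon> / 3"
        using n[OF \<omega>] n[OF \<theta>] by simp_all
      then show ?thesis
        using triangle''[OF fibre_point_closed[OF pf \<omega>] prefix_map_closed[OF \<omega> x, of n]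
            fibre_point_closed[OF pf \<theta>]] \<open>\<epsilon> > 0\<close> by linarith
    qed
    then show ?thesis by (intro exI[of _ "(1 / 2) ^ Suc n"]) auto
  qed
  then show ?thesis
    unfolding W.metric_continuous_map[OF Metric_space_axioms] using fibre_point_closed[OF pf] by blast
qed

definition fibre_set :: "'a set"
  where "fibre_set = fibre_point ` inf_words I"

text \<open>Every infinite word is \<open>shift_in i \<theta>\<close> for its first letter \<open>i\<close> and its tail \<open>\<theta>\<close>.\<close>

lemma fibre_set_invariant:
  assumes pf: "point_fibred"
  shows "(\<Union>i\<in>I. f i ` fibre_set) = fibre_set"
proof (intro equalityI subsetI)
  fix z assume "z \<in> (\<Union>i\<in>I. f i ` fibre_set)"
  then show "z \<in> fibre_set"
    using fibre_point_shift_in[OF pf] shift_in_inf_words unfolding fibre_set_def by force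
next
  fix z assume "z \<in> fibre_set"
  then obtain \<omega> where \<omega>: "\<omega> \<in> inf_words I" "z = fibre_point \<omega>" by (auto simp: fibre_set_def)
  from \<omega>(1) obtain i \<theta> where i: "i \<in> I" "\<theta> \<in> inf_words I" "\<omega> = shift_in i \<theta>"
    by (rule inf_words_decompose)
  then have "z = f i (fibre_point \<theta>)" using fibre_point_shift_in[OF pf] \<omega>(2) by simp
  moreover have "fibre_point \<theta> \<in> fibre_set" using i(2) unfolding fibre_set_def by blast
  ultimately show "z \<in> (\<Union>i\<in>I. f i ` fibre_set)" using i(1) by blast
qed

lemma fibre_set_nonempty: "fibre_set \<noteq> {}"
proof -
  obtain \<omega> where "\<omega> \<in> inf_words I" using extend_to_inf_word[of "[]" I] I_nonempty by auto
  then show ?thesis by (auto simp: fibre_set_def)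
qed

lemma compactin_word_image:
  assumes "continuous_map (Metric_space.mtopology (inf_words I) word_dist) mtopology \<pi>"
  shows "compactin mtopology (\<pi> ` inf_words I)"
proof -
  interpret W: Metric_space "inf_words I" word_dist by (rule Metric_space_words)
  show ?thesis
    using image_compactin[OF _ assms] compact_space_words[OF I_finite I_nonempty]
    by (simp add: compact_space_def)
qed

lemma uniformly_point_fibred_imp_locally:
  assumes "uniformly_point_fibred"
  shows "locally_uniformly_point_fibred"
  unfolding locally_uniformly_point_fibred_def max_deviation_tendsto_0_iff
proof (intro conjI ballI)
  fix x assume "x \<in> X"
  then show "\<exists>D. openin mtopology D \<and> x \<in> D \<and> uniform_fibres_on D"
    using assms uniformly_point_fibred_iff by (intro exI[of _ "mball x 1"]) auto
qed (use assms uniformly_point_fibred_iff in blast)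

lemma Max_diam_tendsto_0_iff:
  assumes "M \<in> Pbcl"
  shows "(\<lambda>n. Max ((\<lambda>w. diam (word_map f w ` M)) ` fin_words n I)) \<longlonglongrightarrow> 0 \<longleftrightarrow> shrinks_on M"
    (is "?D \<longlonglongrightarrow> 0 \<longleftrightarrow> _")
proof -
  have M: "M \<noteq> {}" "mbounded M" using assms by (auto simp: Pbcl_def)
  have im: "mbounded (word_map f w ` M)" "word_map f w ` M \<noteq> {}" if "w \<in> lists I" for w
    using mbounded_word_map_image[OF that M(2)] M(1) by auto
  have fin: "finite ((\<lambda>w. diam (word_map f w ` M)) ` fin_words n I)"
    "(\<lambda>w. diam (word_map f w ` M)) ` fin_words n I \<noteq> {}" for n
    using finite_fin_words[OF I_finite] fin_words_nonempty[OF I_nonempty] by auto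
  have nonneg: "0 \<le> ?D n" for n
  proof -
    obtain w where w: "w \<in> fin_words n I" using fin_words_nonempty[OF I_nonempty] by blast
    then have "0 \<le> diam (word_map f w ` M)" using im by (intro diam_nonneg) (auto simp: fin_words_eq)
    also have "\<dots> \<le> ?D n" using w fin by (intro Max_ge) auto
    finally show ?thesis .
  qed
  have le_iff: "?D n \<le> \<epsilon> \<longleftrightarrow>
    (\<forall>w\<in>lists I. length w = n \<longrightarrow> (\<forall>x\<in>M. \<forall>y\<in>M. d (word_map f w x) (word_map f w y) \<le> \<epsilon>))" for n \<epsilon>
  proof -
    have "diam (word_map f w ` M) \<le> \<epsilon> \<longleftrightarrow> (\<forall>x\<in>M. \<forall>y\<in>M. d (word_map f w x) (word_map f w y) \<le> \<epsilon>)"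
      if "w \<in> lists I" for w
    proof
      assume "diam (word_map f w ` M) \<le> \<epsilon>"
      then show "\<forall>x\<in>M. \<forall>y\<in>M. d (word_map f w x) (word_map f w y) \<le> \<epsilon>"
        using dist_le_diam[OF im(1)[OF that]] order_trans by blast
    next
      assume "\<forall>x\<in>M. \<forall>y\<in>M. d (word_map f w x) (word_map f w y) \<le> \<epsilon>"
      then show "diam (word_map f w ` M) \<le> \<epsilon>"
        by (intro diam_leI im(2) that) auto
    qed
    then show ?thesis using fin by (auto simp: fin_words_eq)
  qed
  have "?D \<longlonglongrightarrow> 0 \<longleftrightarrow> (\<forall>\<epsilon>>0. \<exists>N. \<forall>n\<ge>N. ?D n \<le> \<epsilon>)"
  proof
    assume "?D \<longlonglongrightarrow> 0"
    then show "\<forall>\<epsilon>>0. \<exists>N. \<forall>n\<ge>N. ?D n \<le> \<epsilon>"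
      using order_tendstoD(2)[of ?D 0 sequentially] unfolding eventually_sequentially
      by (meson less_imp_le)
  next
    assume R: "\<forall>\<epsilon>>0. \<exists>N. \<forall>n\<ge>N. ?D n \<le> \<epsilon>"
    show "?D \<longlonglongrightarrow> 0"
    proof (rule order_tendstoI)
      fix a :: real assume "a < 0"
      then show "\<forall>\<^sub>F n in sequentially. a < ?D n" 
        by (intro always_eventually allI less_le_trans[OF _ nonneg])
    next
      fix a :: real assume "0 < a"
      then obtain N where "\<forall>n\<ge>N. ?D n \<le> a / 2" using R by (meson half_gt_zero)
      moreover have "a / 2 < a" using \<open>0 < a\<close> by simp
      ultimately show "\<forall>\<^sub>F n in sequentially. ?D n < a"
        unfolding eventually_sequentially using le_less_trans by blast
    qed
  qed
  also have "\<dots> \<longleftrightarrow> shrinks_on M" unfolding le_iff shrinks_on_def by blast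
  finally show ?thesis .
qed

text \<open>The set \<open>M\<close> is the closure of the orbit of \<open>B\<close> under all finite words.  It is bounded: the images
  under words of length at least \<open>N\<close> lie within distance 1 of the compact fibre set, and the shorter
  words are finite in number.\<close>

lemma uniformly_point_fibred_imp_diameter_diminishing:
  assumes U: "uniformly_point_fibred"
  shows "diameter_diminishing"
  unfolding diameter_diminishing_def
proof
  fix B assume B: "B \<in> Pbcl"
  have pf: "point_fibred" and unif: "\<And>B. mbounded B \<Longrightarrow> uniform_fibres_on B"
    using U uniformly_point_fibred_iff by auto
  from X_nonempty obtain x0 where x0: "x0 \<in> X" by blast
  have bB: "mbounded B" "B \<subseteq> X" "B \<noteq> {}" using B mbounded_subset_mspace by (auto simp: Pbcl_def)
  obtain N where N: "\<And>w \<omega> y. w \<in> lists I \<Longrightarrow> length w \<ge> N \<Longrightarrow> \<omega> \<in> inf_words I \<Longrightarrow> y \<in> B \<Longrightarrow>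
      d (word_map f w y) (fibre_point (prepend_word w \<omega>)) \<le> 1"
    using unif[OF bB(1)] unfolding uniform_fibres_on_def by (meson zero_less_one)
  have "compactin mtopology fibre_set"
    unfolding fibre_set_def
    using compactin_word_image[OF continuous_fibre_point[OF pf x0 unif]] x0 by (simp add: mbounded_insert)
  then have "mbounded fibre_set" by (rule compactin_imp_mbounded)
  then obtain a r where ar: "a \<in> X" "\<And>z. z \<in> fibre_set \<Longrightarrow> d a z \<le> r"
    using fibre_set_nonempty unfolding mbounded by blast
  define S where "S = (\<Union>w\<in>lists I. word_map f w ` B)"
  have SX: "S \<subseteq> X" unfolding S_def using word_map_closed bB(2) by blast
  have BS: "B \<subseteq> S" unfolding S_def by (rule subset_trans[OF _ UN_upper[of "[]"]]) auto
  have "S \<subseteq> (\<Union>k\<in>{..<N}. \<Union>w\<in>fin_words k I. word_map f w ` B) \<union> mcball a (r + 1)"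
  proof
    fix z assume z: "z \<in> S"
    then obtain w y where w: "w \<in> lists I" "y \<in> B" "z = word_map f w y" by (auto simp: S_def)
    show "z \<in> (\<Union>k\<in>{..<N}. \<Union>w\<in>fin_words k I. word_map f w ` B) \<union> mcball a (r + 1)"
    proof (cases "length w < N")
      case True
      then show ?thesis using w by (auto simp: fin_words_eq)
    next
      case False
      obtain \<omega> where \<omega>: "\<omega> \<in> inf_words I" using extend_to_inf_word[of "[]" I] I_nonempty by auto
      let ?p = "fibre_point (prepend_word w \<omega>)"
      have w\<omega>: "prepend_word w \<omega> \<in> inf_words I" using w(1) \<omega> by (rule prepend_word_inf_words)
      have p: "?p \<in> fibre_set" "?p \<in> X"
        using w\<omega> fibre_point_closed[OF pf] by (auto simp: fibre_set_def)
      have "d z ?p \<le> 1" using N[OF w(1) _ \<omega> w(2)] False w(3) by simp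
      moreover have zX: "z \<in> X" using z SX by blast
      ultimately have "d a z \<le> r + 1"
        using triangle'[OF ar(1) p(2) zX] ar(2)[OF p(1)] by linarith
      then show ?thesis using ar(1) zX by simp
    qed
  qed
  moreover have "mbounded ((\<Union>k\<in>{..<N}. \<Union>w\<in>fin_words k I. word_map f w ` B) \<union> mcball a (r + 1))"
    unfolding mbounded_Un
    by (intro conjI mbounded_mcball mbounded_Union) (auto intro: mbounded_words_image bB(1))
  ultimately have bS: "mbounded S" using mbounded_subset by blast
  define M where "M = mtopology closure_of S"
  have M: "M \<in> Pbcl" unfolding M_def using Pbcl_closure BS bB bS by blast
  have "B \<subseteq> M" unfolding M_def using BS subset_closure[OF SX] by blast
  moreover have "fractal_operator M \<subseteq> M"
  proof -
    have "f i ` S \<subseteq> S" if i: "i \<in> I" for i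
    proof
      fix z assume "z \<in> f i ` S"
      then obtain w y where w: "w \<in> lists I" "y \<in> B" "z = f i (word_map f w y)" by (auto simp: S_def)
      then have "z = word_map f (i # w) y" "i # w \<in> lists I" using i by auto
      then show "z \<in> S" unfolding S_def using w(2) by blast
    qed
    then have "fractal_operator S \<subseteq> M" unfolding fractal_operator_def M_def by (intro closure_of_mono) blast
    then show ?thesis unfolding M_def fractal_operator_closure[OF SX] .
  qed
  moreover have "(\<lambda>n. Max ((\<lambda>w. diam (word_map f w ` M)) ` fin_words n I)) \<longlonglongrightarrow> 0"
    unfolding Max_diam_tendsto_0_iff[OF M]
  proof (rule uniform_fibres_on_imp_shrinks_on[OF pf unif])
    show "mbounded M" "M \<subseteq> X" using M mbounded_subset_mspace by (auto simp: Pbcl_def)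
  qed
  ultimately show "\<exists>M\<in>Pbcl. B \<subseteq> M \<and> fractal_operator M \<subseteq> M \<and>
      (\<lambda>n. Max ((\<lambda>w. diam (word_map f w ` M)) ` fin_words n I)) \<longlonglongrightarrow> 0" using M by blast
qed

text \<open>For \<open>x, y \<in> M\<close> both \<open>f\<^sub>u x\<close> and \<open>f\<^bsub>u @ v\<^esub> y\<close> lie in \<open>f\<^sub>u M\<close>, because \<open>f\<^sub>v M \<subseteq> M\<close>.\<close>

lemma diameter_diminishing_imp_uniformly_point_fibred:
  assumes D: "diameter_diminishing"
  shows "uniformly_point_fibred"
proof (rule uniformly_point_fibredI)
  fix B and \<epsilon> :: real assume B: "mbounded B" and "\<epsilon> > 0"
  have BX: "B \<subseteq> X" using B by (rule mbounded_subset_mspace)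
  from X_nonempty obtain x0 where x0: "x0 \<in> X" by blast
  have iB: "mbounded (insert x0 B)" "insert x0 B \<subseteq> X" using B BX x0 by (auto simp: mbounded_insert)
  then have "mtopology closure_of (insert x0 B) \<in> Pbcl" by (intro Pbcl_closure) auto
  then obtain M where M: "M \<in> Pbcl" "mtopology closure_of (insert x0 B) \<subseteq> M" "fractal_operator M \<subseteq> M"
    and lim: "(\<lambda>n. Max ((\<lambda>w. diam (word_map f w ` M)) ` fin_words n I)) \<longlonglongrightarrow> 0"
    using D unfolding diameter_diminishing_def by blast
  have BM: "B \<subseteq> M" using subset_closure[OF iB(2)] M(2) by blast
  have MX: "M \<subseteq> X" using M(1) mbounded_subset_mspace by (auto simp: Pbcl_def)
  have fM: "f i x \<in> M" if "i \<in> I" "x \<in> M" for i x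
  proof -
    have "(\<Union>i\<in>I. f i ` M) \<subseteq> fractal_operator M"
      unfolding fractal_operator_def using MX f_closed by (intro subset_closure) blast
    then show ?thesis using M(3) that by blast
  qed
  have wM: "word_map f v y \<in> M" if "v \<in> lists I" "y \<in> M" for v y
    using that by (induction v) (auto simp: fM)
  obtain N where N: "\<And>w x y. w \<in> lists I \<Longrightarrow> length w \<ge> N \<Longrightarrow> x \<in> M \<Longrightarrow> y \<in> M \<Longrightarrow>
      d (word_map f w x) (word_map f w y) \<le> \<epsilon>"
    using lim[unfolded Max_diam_tendsto_0_iff[OF M(1)] shrinks_on_def] \<open>\<epsilon> > 0\<close> by meson
  have "d (word_map f u x) (word_map f (u @ v) y) \<le> \<epsilon>"
    if "u \<in> lists I" "v \<in> lists I" "length u \<ge> N" "x \<in> B" "y \<in> B" for u v x y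
    unfolding word_map_append using that BM by (intro N wM) auto
  then show "\<exists>N. \<forall>u\<in>lists I. \<forall>v\<in>lists I. length u \<ge> N \<longrightarrow>
    (\<forall>x\<in>B. \<forall>y\<in>B. d (word_map f u x) (word_map f (u @ v) y) \<le> \<epsilon>)" by blast
qed

text \<open>Every point of \<open>f\<^sub>w B\<close> is near the fibre point of any infinite word extending \<open>w\<close>, and every fibre
  point \<open>a\<^sub>\<omega>\<close> is near the image of \<open>B\<close> under the prefix of \<open>\<omega>\<close> of length \<open>n\<close>.\<close>

lemma uniformly_point_fibred_imp_is_attractor:
  assumes U: "uniformly_point_fibred"
  shows "is_attractor fibre_set"
  unfolding is_attractor_def
proof (intro conjI ballI)
  have pf: "point_fibred" and unif: "\<And>B. mbounded B \<Longrightarrow> uniform_fibres_on B"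
    using U uniformly_point_fibred_iff by auto
  from X_nonempty obtain x0 where x0: "x0 \<in> X" by blast
  have cpt: "compactin mtopology fibre_set"
    unfolding fibre_set_def
    using compactin_word_image[OF continuous_fibre_point[OF pf x0 unif]] x0 by (simp add: mbounded_insert)
  then have clo: "closedin mtopology fibre_set"
    using compactin_imp_closedin Hausdorff_space_mtopology by blast
  show "fibre_set \<in> Pbcl"
    unfolding Pbcl_def using fibre_set_nonempty clo compactin_imp_mbounded[OF cpt] by blast
  show "fractal_operator fibre_set = fibre_set"
    unfolding fractal_operator_def fibre_set_invariant[OF pf] using clo by (simp add: closure_of_closedin)
  have FX: "fibre_set \<subseteq> X" using clo closedin_subset by fastforce
  fix B assume B: "B \<in> Pbcl"
  then have bB: "mbounded B" "B \<subseteq> X" "B \<noteq> {}" using mbounded_subset_mspace by (auto simp: Pbcl_def)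
  have key: "\<exists>N. \<forall>n\<ge>N. 0 \<le> Hausdorff_dist ((fractal_operator ^^ n) B) fibre_set \<and>
      Hausdorff_dist ((fractal_operator ^^ n) B) fibre_set \<le> \<epsilon>" if \<epsilon>: "\<epsilon> > 0" for \<epsilon>
  proof -
    obtain N where N: "\<And>n \<omega> y. n \<ge> N \<Longrightarrow> \<omega> \<in> inf_words I \<Longrightarrow> y \<in> B \<Longrightarrow>
        d (word_map f (prefix_word \<omega> n) y) (fibre_point \<omega>) \<le> \<epsilon> / 2"
      using uniform_fibres_on_prefix[OF unif[OF bB(1)], of "\<epsilon> / 2"] \<epsilon> by (meson half_gt_zero)
    have "0 \<le> Hausdorff_dist ((fractal_operator ^^ n) B) fibre_set \<and>
      Hausdorff_dist ((fractal_operator ^^ n) B) fibre_set \<le> \<epsilon>" if n: "n \<ge> N" for n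
    proof -
      let ?S = "\<Union>w\<in>fin_words n I. word_map f w ` B"
      have SX: "?S \<subseteq> X" using bB(2) word_map_closed by (fastforce simp: fin_words_eq)
      have 1: "\<exists>b\<in>fibre_set. d z b \<le> \<epsilon>" if z: "z \<in> mtopology closure_of ?S" for z
      proof -
        \<comment> \<open>A point of the closure is first replaced by a point of \<open>?S\<close> itself; hence the halves.\<close>
        have "\<forall>r>0. \<exists>s\<in>?S. s \<in> mball z r" and zX: "z \<in> X"
          using z unfolding metric_closure_of by simp_all
        then obtain s where s: "s \<in> ?S" "s \<in> mball z (\<epsilon> / 2)" using half_gt_zero[OF \<epsilon>] by meson
        then have s': "s \<in> X" "d z s < \<epsilon> / 2" by simp_all
        obtain w y where w: "w \<in> lists I" "length w = n" "y \<in> B" "s = word_map f w y"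
          using s(1) by (auto simp: fin_words_eq)
        obtain \<omega> where \<omega>: "\<omega> \<in> inf_words I" "prefix_word \<omega> (length w) = w"
          using w(1) I_nonempty by (rule extend_to_inf_word)
        have "d s (fibre_point \<omega>) \<le> \<epsilon> / 2" using N[OF n \<omega>(1) w(3)] \<omega>(2) w(2,4) by simp
        then have "d z (fibre_point \<omega>) \<le> \<epsilon>"
          using triangle[OF zX s'(1) fibre_point_closed[OF pf \<omega>(1)]] s'(2) by simp
        then show ?thesis using \<omega>(1) unfolding fibre_set_def by blast
      qed
      have 2: "\<exists>z\<in>mtopology closure_of ?S. d z b \<le> \<epsilon>" if b: "b \<in> fibre_set" for b
      proof -
        obtain \<omega> where \<omega>: "\<omega> \<in> inf_words I" "b = fibre_point \<omega>" using b by (auto simp: fibre_set_def)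
        obtain y where y: "y \<in> B" using bB(3) by blast
        have "prefix_word \<omega> n \<in> fin_words n I"
          using prefix_word_in_lists[OF \<omega>(1)] by (simp add: fin_words_eq)
        then have "word_map f (prefix_word \<omega> n) y \<in> mtopology closure_of ?S"
          using y subset_closure[OF SX] by blast
        moreover have "d (word_map f (prefix_word \<omega> n) y) b \<le> \<epsilon>"
          using N[OF n \<omega>(1) y] \<omega>(2) \<open>\<epsilon> > 0\<close> by simp
        ultimately show ?thesis by blast
      qed
      have "mtopology closure_of ?S \<noteq> {}" using fibre_set_nonempty 2 by blast
      then show ?thesis
        unfolding fractal_operator_funpow[OF B]
        using Hausdorff_dist_leI[OF _ fibre_set_nonempty 1 2] by blast
    qed
    then show ?thesis by blast
  qed
  show "(\<lambda>n. Hausdorff_dist ((fractal_operator ^^ n) B) fibre_set) \<longlonglongrightarrow> 0"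
  proof (rule LIMSEQ_I)
    fix r :: real assume "r > 0"
    then obtain N where "\<forall>n\<ge>N. 0 \<le> Hausdorff_dist ((fractal_operator ^^ n) B) fibre_set \<and>
        Hausdorff_dist ((fractal_operator ^^ n) B) fibre_set \<le> r / 2"
      using key[of "r / 2"] by auto
    then show "\<exists>N. \<forall>n\<ge>N. norm (Hausdorff_dist ((fractal_operator ^^ n) B) fibre_set - 0) < r"
      using \<open>r > 0\<close> by (intro exI[of _ N]) (auto intro: le_less_trans)
  qed
qed

text \<open>Split a long word as \<open>u @ v\<close> with \<open>u\<close> of a fixed length \<open>m\<close>.  If \<open>m\<close> is large, \<open>f\<^sub>u A\<close> is small by
  uniform continuity of \<open>\<pi>\<close>.  As only finitely many \<open>u\<close> occur, they share one \<open>\<delta>\<close> such that points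
  \<open>\<delta>\<close>-near to \<open>A\<close> are mapped near to \<open>f\<^sub>u A\<close>; and since the iterates of the unit ball around \<open>x\<close>
  converge to \<open>A\<close>, the images under \<open>f\<^sub>v\<close> are \<open>\<delta>\<close>-near to \<open>A\<close> once \<open>v\<close> is long.\<close>

lemma attractor_imp_locally_uniformly_point_fibred:
  assumes A: "is_attractor A"
    and cont: "continuous_map (Metric_space.mtopology (inf_words I) word_dist) mtopology \<pi>"
    and onto: "\<pi> ` inf_words I = A"
    and conj: "\<And>i \<omega>. i \<in> I \<Longrightarrow> \<omega> \<in> inf_words I \<Longrightarrow> f i (\<pi> \<omega>) = \<pi> (shift_in i \<omega>)"
  shows "locally_uniformly_point_fibred"
proof -
  interpret W: Metric_space "inf_words I" word_dist by (rule Metric_space_words)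
  have \<pi>X: "\<pi> \<omega> \<in> X" if "\<omega> \<in> inf_words I" for \<omega>
    using continuous_map_image_subset_topspace[OF cont] that by auto
  have cpt: "compactin mtopology A" using compactin_word_image[OF cont] onto by simp
  have A_ne: "A \<noteq> {}" "mbounded A" using A by (auto simp: is_attractor_def Pbcl_def)
  have AX: "A \<subseteq> X" using A_ne(2) by (rule mbounded_subset_mspace)
  have "mtopology_of W.Self = W.mtopology" "mtopology_of Self = mtopology"
    by (simp_all add: W.Self_def Self_def)
  then have "uniformly_continuous_map W.Self Self \<pi>"
    using continuous_imp_uniformly_continuous_map[of W.Self Self \<pi>] cont
      compact_space_words[OF I_finite I_nonempty] by simp
  then have unif: "\<exists>\<delta>>0. \<forall>\<omega>\<in>inf_words I. \<forall>\<theta>\<in>inf_words I. word_dist \<omega> \<theta> < \<delta> \<longrightarrow> d (\<pi> \<omega>) (\<pi> \<theta>) < \<epsilon>"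
    if "\<epsilon> > 0" for \<epsilon>
    using that unfolding uniformly_continuous_map_def by (simp add: W.commute commute)
  have key: "\<exists>N. \<forall>w\<in>lists I. length w \<ge> N \<longrightarrow>
      (\<forall>\<omega>\<in>inf_words I. \<forall>y\<in>mball x 1. d (word_map f w y) (\<pi> (prepend_word w \<omega>)) \<le> \<epsilon>)"
    if x: "x \<in> X" and \<epsilon>: "\<epsilon> > 0" for x \<epsilon>
  proof -
    obtain \<delta>1 where \<delta>1: "\<delta>1 > 0" "\<And>\<omega> \<theta>. \<omega> \<in> inf_words I \<Longrightarrow> \<theta> \<in> inf_words I \<Longrightarrow>
        word_dist \<omega> \<theta> < \<delta>1 \<Longrightarrow> d (\<pi> \<omega>) (\<pi> \<theta>) < \<epsilon> / 2"
      using unif[of "\<epsilon> / 2"] \<epsilon> by auto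
    obtain m where "(1 / 2) ^ m < \<delta>1"
      using real_arch_pow_inv[OF \<delta>1(1), of "1 / 2"] by auto
    moreover have "(1 / 2 :: real) ^ Suc m \<le> (1 / 2) ^ m" by simp
    ultimately have m: "(1 / 2) ^ Suc m < \<delta>1" by linarith
    let ?G = "word_map f ` fin_words m I"
    have finG: "finite ?G" using I_finite by (simp add: finite_fin_words)
    have contG: "continuous_map mtopology mtopology g" if "g \<in> ?G" for g
      using that continuous_word_map by (auto simp: fin_words_eq)
    obtain \<delta> where \<delta>: "\<delta> > 0" "\<And>g a y. g \<in> ?G \<Longrightarrow> a \<in> A \<Longrightarrow> y \<in> X \<Longrightarrow> d a y < \<delta> \<Longrightarrow> d (g a) (g y) < \<epsilon> / 2"
      using equicontinuous_near_compact[OF cpt finG contG half_gt_zero[OF \<epsilon>]] by blast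
    let ?B = "mcball x 1"
    have B: "?B \<in> Pbcl" "mbounded ?B" using x by (simp_all add: Pbcl_mcball mbounded_mcball)
    have "(\<lambda>n. Hausdorff_dist ((fractal_operator ^^ n) ?B) A) \<longlonglongrightarrow> 0"
      using A B by (simp add: is_attractor_def)
    from order_tendstoD(2)[OF this \<delta>(1)] obtain k where
      k: "\<And>n. n \<ge> k \<Longrightarrow> Hausdorff_dist ((fractal_operator ^^ n) ?B) A < \<delta>"
      by (auto simp: eventually_sequentially)
    have "d (word_map f w y) (\<pi> (prepend_word w \<omega>)) \<le> \<epsilon>"
      if w: "w \<in> lists I" "length w \<ge> m + k" and \<omega>: "\<omega> \<in> inf_words I" and y: "y \<in> mball x 1" for w \<omega> y
    proof -
      define u v where "u = take m w" and "v = drop m w"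
      have uv: "w = u @ v" by (simp add: u_def v_def)
      then have uvl: "u \<in> lists I" "v \<in> lists I" using w(1) by auto
      have len: "length u = m" "length v \<ge> k" using w(2) by (auto simp: u_def v_def)
      have yB: "y \<in> ?B" "y \<in> X" using y by auto
      let ?n = "length v" and ?S = "\<Union>w\<in>fin_words (length v) I. word_map f w ` ?B"
      have bS: "mbounded ?S" by (rule mbounded_words_image[OF B(2)])
      have "word_map f v y \<in> ?S" using uvl yB by (auto simp: fin_words_eq)
      then have "word_map f v y \<in> (fractal_operator ^^ ?n) ?B"
        unfolding fractal_operator_funpow[OF B(1)] using subset_closure[OF mbounded_subset_mspace[OF bS]] by blast
      moreover have "mbounded ((fractal_operator ^^ ?n) ?B)"
        unfolding fractal_operator_funpow[OF B(1)] using bS by (rule mbounded_closure_of)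
      ultimately obtain a where a: "a \<in> A" "d (word_map f v y) a < \<delta>"
        using Hausdorff_dist_lessD[OF k[OF len(2)] _ A_ne(2,1)] by blast
      obtain \<theta> where \<theta>: "\<theta> \<in> inf_words I" "a = \<pi> \<theta>" using a(1) onto by blast
      have vy: "word_map f v y \<in> X" by (rule word_map_closed[OF uvl(2) yB(2)])
      have u: "word_map f u \<in> ?G" using uvl(1) len(1) by (auto simp: fin_words_eq)
      have "d (word_map f u a) (word_map f u (word_map f v y)) < \<epsilon> / 2"
        using \<delta>(2)[OF u a(1) vy] a(2) by (simp add: commute)
      moreover have "word_map f u a = \<pi> (prepend_word u \<theta>)"
        unfolding \<theta>(2) by (rule conjugation_prepend_word[OF conj uvl(1) \<theta>(1)])
      ultimately have 1: "d (word_map f w y) (\<pi> (prepend_word u \<theta>)) < \<epsilon> / 2"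
        by (simp add: uv word_map_append commute)
      have pw: "prepend_word w \<omega> = prepend_word u (prepend_word v \<omega>)" by (simp add: uv)
      have v\<omega>: "prepend_word v \<omega> \<in> inf_words I" by (rule prepend_word_inf_words[OF uvl(2) \<omega>])
      have in_words: "prepend_word u \<theta> \<in> inf_words I" "prepend_word w \<omega> \<in> inf_words I"
        using prepend_word_inf_words[OF uvl(1) \<theta>(1)] prepend_word_inf_words[OF w(1) \<omega>] by auto
      have "word_dist (prepend_word u \<theta>) (prepend_word w \<omega>) \<le> (1 / 2) ^ Suc m"
        unfolding word_dist_le_iff pw using prefix_prepend_word[OF len(1)] by simp
      then have 2: "d (\<pi> (prepend_word u \<theta>)) (\<pi> (prepend_word w \<omega>)) < \<epsilon> / 2"
        using m by (intro \<delta>1(2) in_words) simp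
      show ?thesis
        using triangle[OF word_map_closed[OF w(1) yB(2)] \<pi>X[OF in_words(1)] \<pi>X[OF in_words(2)]] 1 2
        by simp
    qed
    then show ?thesis by blast
  qed
  have limit: "fibre_limit \<omega> (\<pi> \<omega>)" if \<omega>: "\<omega> \<in> inf_words I" for \<omega>
    unfolding fibre_limit_def limit_metric_sequentially
  proof (intro conjI ballI allI impI \<pi>X \<omega>)
    fix x and \<epsilon> :: real assume x: "x \<in> X" and "\<epsilon> > 0"
    have xb: "x \<in> mball x 1" using x by simp
    obtain N where N: "\<And>w \<omega>. w \<in> lists I \<Longrightarrow> length w \<ge> N \<Longrightarrow> \<omega> \<in> inf_words I \<Longrightarrow>
        d (word_map f w x) (\<pi> (prepend_word w \<omega>)) \<le> \<epsilon> / 2"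
      using key[OF x half_gt_zero[OF \<open>\<epsilon> > 0\<close>]] xb by blast
    have "d (word_map f (prefix_word \<omega> n) x) (\<pi> \<omega>) < \<epsilon>" if "n \<ge> N" for n
    proof -
      have "d (word_map f (prefix_word \<omega> n) x) (\<pi> (prepend_word (prefix_word \<omega> n) (\<lambda>k. \<omega> (n + k)))) \<le> \<epsilon> / 2"
        using that by (intro N prefix_word_in_lists shifted_inf_words \<omega>) simp
      then show ?thesis using \<open>\<epsilon> > 0\<close> by (simp add: prepend_prefix_word)
    qed
    then show "\<exists>N. \<forall>n\<ge>N. word_map f (prefix_word \<omega> n) x \<in> X \<and> d (word_map f (prefix_word \<omega> n) x) (\<pi> \<omega>) < \<epsilon>"
      using prefix_map_closed[OF \<omega> x] by blast
  qed
  have pf: "point_fibred" unfolding point_fibred_def using limit by blast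
  have "uniform_fibres_on (mball x 1)" if "x \<in> X" for x
    unfolding uniform_fibres_on_def
  proof (intro allI impI)
    fix \<epsilon> :: real assume "\<epsilon> > 0"
    have "fibre_point (prepend_word w \<omega>) = \<pi> (prepend_word w \<omega>)"
      if "w \<in> lists I" "\<omega> \<in> inf_words I" for w \<omega>
      using that by (intro fibre_point_eqI limit prepend_word_inf_words)
    then show "\<exists>N. \<forall>w\<in>lists I. length w \<ge> N \<longrightarrow>
      (\<forall>\<omega>\<in>inf_words I. \<forall>y\<in>mball x 1. d (word_map f w y) (fibre_point (prepend_word w \<omega>)) \<le> \<epsilon>)"
      using key[OF \<open>x \<in> X\<close> \<open>\<epsilon> > 0\<close>] by (simp del: in_mball)
  qed
  then show ?thesis
    unfolding locally_uniformly_point_fibred_def max_deviation_tendsto_0_iff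
    using pf by (metis centre_in_mball_iff openin_mball zero_less_one)
qed

end

section \<open>Remetrization of locally uniformly point fibred systems\<close>

text \<open>Think of \<open>(t, t')\<close> as a distance and the distance of the images.  A contraction
  ratio \<open>q s < 1\<close> that depends on a lower bound \<open>s\<close> for the distance gives
  \<open>t' \<le> max s (q s * t)\<close> for every \<open>s > 0\<close>: use the ratio if \<open>s \<le> t\<close>, and \<open>t' \<le> t\<close> otherwise.  The
  infimum over \<open>s\<close> is increasing, it is right-continuous as an increasing infimum of continuous
  functions, and \<open>s = t / 2\<close> shows that it is below \<open>t\<close>.\<close>

lemma comparison_function_of_ratios:
  fixes R :: "(real \<times> real) set"
  assumes le: "\<And>t t'. (t, t') \<in> R \<Longrightarrow> 0 \<le> t \<and> t' \<le> t"
    and ratio: "\<And>s. s > 0 \<Longrightarrow> \<exists>q. 0 \<le> q \<and> q < 1 \<and> (\<forall>(t, t')\<in>R. s \<le> t \<longrightarrow> t' \<le> q * t)"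
  shows "\<exists>\<phi>. comparison_function \<phi> \<and> (\<forall>(t, t')\<in>R. t' \<le> \<phi> t)"
proof -
  obtain q where q: "\<And>s. s > 0 \<Longrightarrow> 0 \<le> q s" "\<And>s. s > 0 \<Longrightarrow> q s < 1"
    "\<And>s t t'. s > 0 \<Longrightarrow> (t, t') \<in> R \<Longrightarrow> s \<le> t \<Longrightarrow> t' \<le> q s * t"
  proof -
    have "\<forall>s. \<exists>q. s > 0 \<longrightarrow> 0 \<le> q \<and> q < 1 \<and> (\<forall>(t, t')\<in>R. s \<le> t \<longrightarrow> t' \<le> q * t)"
      using ratio by blast
    from choice[OF this] obtain q where
      "\<forall>s. s > 0 \<longrightarrow> 0 \<le> q s \<and> q s < 1 \<and> (\<forall>(t, t')\<in>R. s \<le> t \<longrightarrow> t' \<le> q s * t)" by blast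
    then show thesis using that[of q] by fast
  qed
  define \<phi> where "\<phi> t = (INF s\<in>{0<..}. max s (q s * t))" for t
  have bdd: "bdd_below ((\<lambda>s. max s (q s * t)) ` {0<..})" for t
    by (rule bdd_belowI[of _ 0]) (auto intro: max.coboundedI1)
  have ne: "{0<..} \<noteq> ({} :: real set)" by (auto intro: exI[of _ 1])
  have lower: "\<phi> t \<le> max s (q s * t)" if "s > 0" for s t
    unfolding \<phi>_def using bdd that by (intro cINF_lower) auto
  have greatest: "a \<le> \<phi> t" if "\<And>s. s > 0 \<Longrightarrow> a \<le> max s (q s * t)" for a t
    unfolding \<phi>_def using ne that by (intro cINF_greatest) auto
  have mono: "\<phi> s \<le> \<phi> t" if "s \<le> t" for s t
  proof (rule greatest)
    fix u :: real assume "u > 0"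
    then have "q u * s \<le> q u * t" using q(1) that by (intro mult_left_mono) auto
    then show "\<phi> s \<le> max u (q u * t)" using lower[OF \<open>u > 0\<close>, of s] by linarith
  qed
  have "comparison_function \<phi>"
    unfolding comparison_function_def
  proof (intro conjI allI impI)
    show "\<phi> ` {0..} \<subseteq> {0..}" by (auto intro!: greatest max.coboundedI1)
    show "mono_on {0..} \<phi>" by (rule mono_onI) (rule mono)
    show "\<phi> t < t" if "t > 0" for t
    proof -
      have "q (t / 2) * t < 1 * t" using q(2)[of "t / 2"] that by (intro mult_strict_right_mono) auto
      then have "max (t / 2) (q (t / 2) * t) < t" using that by simp
      then show ?thesis using lower[of "t / 2" t] that by linarith
    qed
    fix t :: real assume "0 \<le> t"
    show "continuous (at_right t) \<phi>"
      unfolding continuous_within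
    proof (rule order_tendstoI)
      fix a assume "a < \<phi> t"
      show "\<forall>\<^sub>F u in at_right t. a < \<phi> u"
        using eventually_at_right_less[of t]
        by (rule eventually_mono) (rule less_le_trans[OF \<open>a < \<phi> t\<close> mono], simp)
    next
      fix a assume "\<phi> t < a"
      then obtain s where s: "s > 0" "max s (q s * t) < a"
        unfolding \<phi>_def by (subst (asm) cINF_less_iff[OF ne bdd]) auto
      have "((\<lambda>u. max s (q s * u)) \<longlongrightarrow> max s (q s * t)) (at_right t)"
        by (intro tendsto_intros)
      from order_tendstoD(2)[OF this s(2)] show "\<forall>\<^sub>F u in at_right t. \<phi> u < a"
        by (rule eventually_mono) (rule le_less_trans[OF lower[OF s(1)]])
    qed
  qed
  moreover have "t' \<le> \<phi> t" if R: "(t, t') \<in> R" for t t'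
  proof (rule greatest)
    fix s :: real assume s: "s > 0"
    show "t' \<le> max s (q s * t)"
      using q(3)[OF s R] le[OF R] by (cases "s \<le> t") auto
  qed
  ultimately show ?thesis by blast
qed

definition pseudometric_on :: "'a set \<Rightarrow> ('a \<Rightarrow> 'a \<Rightarrow> real) \<Rightarrow> bool"
  where "pseudometric_on X p \<longleftrightarrow> (\<forall>x\<in>X. p x x = 0) \<and> (\<forall>x\<in>X. \<forall>y\<in>X. 0 \<le> p x y \<and> p x y = p y x) \<and>
    (\<forall>x\<in>X. \<forall>y\<in>X. \<forall>z\<in>X. p x z \<le> p x y + p y z)"

lemma pseudometric_on_pullback:
  "pseudometric_on Y p \<Longrightarrow> (\<And>x. x \<in> X \<Longrightarrow> g x \<in> Y) \<Longrightarrow> pseudometric_on X (\<lambda>x y. p (g x) (g y))"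
  by (auto simp: pseudometric_on_def)

lemma pseudometric_on_scale:
  "pseudometric_on X p \<Longrightarrow> 0 \<le> c \<Longrightarrow> pseudometric_on X (\<lambda>x y. c * p x y)"
  by (auto simp: pseudometric_on_def distrib_left[symmetric] intro: mult_left_mono)

lemma pseudometric_on_min_one:
  "pseudometric_on X p \<Longrightarrow> pseudometric_on X (\<lambda>x y. min 1 (p x y))"
proof -
  assume p: "pseudometric_on X p"
  have "min 1 (p x z) \<le> min 1 (p x y) + min 1 (p y z)" if "x \<in> X" "y \<in> X" "z \<in> X" for x y z
  proof -
    have "p x z \<le> p x y + p y z" "0 \<le> p x y" "0 \<le> p y z"
      using p that unfolding pseudometric_on_def by blast+
    then show ?thesis by linarith
  qed
  then show ?thesis using p by (auto simp: pseudometric_on_def)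
qed

lemma pseudometric_on_add:
  assumes "pseudometric_on X p" "pseudometric_on X p'"
  shows "pseudometric_on X (\<lambda>x y. p x y + p' x y)"
proof -
  have "p x z + p' x z \<le> (p x y + p' x y) + (p y z + p' y z)" if "x \<in> X" "y \<in> X" "z \<in> X" for x y z
  proof -
    have "p x z \<le> p x y + p y z" "p' x z \<le> p' x y + p' y z"
      using assms that unfolding pseudometric_on_def by blast+
    then show ?thesis by simp
  qed
  then show ?thesis using assms by (auto simp: pseudometric_on_def)
qed

lemma pseudometric_on_SUP:
  assumes S: "S \<noteq> {}" and p: "\<And>s. s \<in> S \<Longrightarrow> pseudometric_on X (p s)"
    and bdd: "\<And>x y. x \<in> X \<Longrightarrow> y \<in> X \<Longrightarrow> bdd_above ((\<lambda>s. p s x y) ` S)"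
  shows "pseudometric_on X (\<lambda>x y. SUP s\<in>S. p s x y)"
  unfolding pseudometric_on_def
proof (intro conjI ballI)
  fix x assume x: "x \<in> X"
  have "p s x x = 0" if "s \<in> S" for s using p[OF that] x by (auto simp: pseudometric_on_def)
  then show "(SUP s\<in>S. p s x x) = 0" using S by simp
next
  fix x y assume xy: "x \<in> X" "y \<in> X"
  have s: "0 \<le> p s x y" "p s x y = p s y x" if "s \<in> S" for s
    using p[OF that] xy by (auto simp: pseudometric_on_def)
  from S obtain s0 where "s0 \<in> S" by blast
  then have "0 \<le> p s0 x y" "p s0 x y \<le> (SUP s\<in>S. p s x y)"
    using s bdd[OF xy] by (auto intro: cSUP_upper)
  then show "0 \<le> (SUP s\<in>S. p s x y)" by simp
  show "(SUP s\<in>S. p s x y) = (SUP s\<in>S. p s y x)" using s(2) by (intro SUP_cong) auto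
next
  fix x y z assume xyz: "x \<in> X" "y \<in> X" "z \<in> X"
  show "(SUP s\<in>S. p s x z) \<le> (SUP s\<in>S. p s x y) + (SUP s\<in>S. p s y z)"
  proof (rule cSUP_least[OF S])
    fix s assume s: "s \<in> S"
    have "p s x z \<le> p s x y + p s y z" using p[OF s] xyz unfolding pseudometric_on_def by blast
    also have "\<dots> \<le> (SUP s\<in>S. p s x y) + (SUP s\<in>S. p s y z)"
      using s bdd xyz by (intro add_mono cSUP_upper) auto
    finally show "p s x z \<le> \<dots>" .
  qed
qed

text \<open>The locale \<^locale>\<open>Metric_space\<close> demands nonnegativity and symmetry on the whole type, not just on the
  carrier; hence the default value 0 outside \<open>X\<close>.\<close>

lemma Metric_space_of_pseudometric:
  assumes "pseudometric_on X p" "\<And>x y. x \<in> X \<Longrightarrow> y \<in> X \<Longrightarrow> p x y = 0 \<Longrightarrow> x = y"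
  shows "Metric_space X (\<lambda>x y. if x \<in> X \<and> y \<in> X then p x y else 0)"
  using assms by unfold_locales (auto simp: pseudometric_on_def)

context Metric_space
begin

lemma pseudometric_on_d: "pseudometric_on M d"
  using triangle commute by (auto simp: pseudometric_on_def)

text \<open>Convergence for \<open>e\<close> implies convergence for \<open>d\<close> because \<open>e\<close> dominates \<open>min 1 d\<close>, and the converse
  holds because \<open>e x\<close> is small near \<open>x\<close>.  Completeness carries over since \<open>e\<close>-Cauchy sequences are
  \<open>d\<close>-Cauchy.\<close>

lemma finer_metric_equivalent:
  assumes e: "Metric_space M e"
    and finer: "\<And>x y. x \<in> M \<Longrightarrow> y \<in> M \<Longrightarrow> min 1 (d x y) \<le> e x y"
    and cont: "\<And>x \<epsilon>. x \<in> M \<Longrightarrow> \<epsilon> > 0 \<Longrightarrow> \<exists>U. openin mtopology U \<and> x \<in> U \<and> (\<forall>y\<in>U. e x y < \<epsilon>)"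
  shows "Metric_space.mtopology M e = mtopology"
    and "mcomplete \<Longrightarrow> Metric_space.mcomplete M e"
proof -
  interpret E: Metric_space M e by (rule e)
  have close: "d x y < \<epsilon>" if "x \<in> M" "y \<in> M" "e x y < min 1 \<epsilon>" for x y \<epsilon>
    using finer[OF that(1,2)] that(3) by linarith
  have "openin E.mtopology U \<longleftrightarrow> openin mtopology U" for U
  proof
    assume U: "openin E.mtopology U"
    show "openin mtopology U"
    proof (subst openin_subopen, intro ballI)
      fix x assume x: "x \<in> U"
      then obtain r where r: "r > 0" "E.mball x r \<subseteq> U" using U by (auto simp: E.openin_mtopology)
      have xM: "x \<in> M" using x U by (auto simp: E.openin_mtopology)
      obtain V where V: "openin mtopology V" "x \<in> V" "\<forall>y\<in>V. e x y < r" using cont[OF xM r(1)] by blast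
      then have "V \<subseteq> E.mball x r" using xM openin_subset[OF V(1)] by auto
      then show "\<exists>T. openin mtopology T \<and> x \<in> T \<and> T \<subseteq> U" using V r(2) by blast
    qed
  next
    assume U: "openin mtopology U"
    show "openin E.mtopology U"
      unfolding E.openin_mtopology
    proof (intro conjI allI impI)
      show "U \<subseteq> M" using U openin_subset by fastforce
      fix x assume "x \<in> U"
      then obtain r where r: "r > 0" "mball x r \<subseteq> U" using U by (auto simp: openin_mtopology)
      have "E.mball x (min 1 r) \<subseteq> mball x r" using close by auto
      then show "\<exists>r>0. E.mball x r \<subseteq> U" using r by (intro exI[of _ "min 1 r"]) auto
    qed
  qed
  then show top: "E.mtopology = mtopology" by (simp add: topology_eq)
  show "E.mcomplete" if mcomplete
    unfolding E.mcomplete_def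
  proof (intro allI impI)
    fix \<sigma> assume \<sigma>: "E.MCauchy \<sigma>"
    have "MCauchy \<sigma>"
      unfolding MCauchy_def
    proof (intro conjI allI impI)
      show r: "range \<sigma> \<subseteq> M" using \<sigma> by (simp add: E.MCauchy_def)
      fix \<epsilon> :: real assume "\<epsilon> > 0"
      then have "min 1 \<epsilon> > 0" by simp
      then obtain N where "\<And>n n'. N \<le> n \<Longrightarrow> N \<le> n' \<Longrightarrow> e (\<sigma> n) (\<sigma> n') < min 1 \<epsilon>"
        using \<sigma> unfolding E.MCauchy_def by meson
      then show "\<exists>N. \<forall>n n'. N \<le> n \<longrightarrow> N \<le> n' \<longrightarrow> d (\<sigma> n) (\<sigma> n') < \<epsilon>"
        using close r by (meson rangeI subsetD)
    qed
    then show "\<exists>x. limitin E.mtopology \<sigma> x sequentially"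
      using that unfolding mcomplete_def top by blast
  qed
qed

end

context IFS
begin

lemma IFS_equivalent_metric:
  assumes e: "Metric_space X e" "Metric_space.mtopology X e = mtopology" "Metric_space.mcomplete X e"
    and nonexp: "\<And>i x y. i \<in> I \<Longrightarrow> x \<in> X \<Longrightarrow> y \<in> X \<Longrightarrow> e (f i x) (f i y) \<le> e x y"
  shows "IFS X e I f"
proof -
  interpret E: Metric_space X e by (rule e)
  show ?thesis
  proof
    fix i B assume i: "i \<in> I" and B: "B \<in> E.Pb"
    then obtain C where C: "\<And>x y. x \<in> B \<Longrightarrow> y \<in> B \<Longrightarrow> e x y \<le> C" and BX: "B \<subseteq> X"
      unfolding E.Pb_def E.mbounded_alt by blast
    have "e (f i x) (f i y) \<le> C" if "x \<in> B" "y \<in> B" for x y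
      using nonexp[OF i, of x y] C[OF that] BX that by fastforce
    then have "E.mbounded (f i ` B)" unfolding E.mbounded_alt using f_closed[OF i] BX by blast
    then show "f i ` B \<in> E.Pb" using B by (simp add: E.Pb_def)
  qed (use e X_nonempty I_finite I_nonempty continuous_f in simp_all)
qed

text \<open>The metric is \<open>e x y = (SUP w. c\<^bsub>|w|\<^esub> * min 1 (d (f\<^sub>w x) (f\<^sub>w y)))\<close>.  Passing from \<open>(x, y)\<close> to
  \<open>(f i x, f i y)\<close> turns the term for \<open>w\<close> into the term for \<open>w @ [i]\<close>, but with the smaller weight
  \<open>c\<^bsub>|w|\<^esub>\<close> instead of \<open>c\<^bsub>|w| + 1\<^esub>\<close>; thus the maps are nonexpansive.  On a set where words shrink uniformly, a
  lower bound \<open>s\<close> for \<open>e x y\<close> makes the terms of long words at most \<open>s / 2\<close>, and for the remaining,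
  boundedly many lengths the quotient of consecutive weights stays away from 1.  Local
  shrinking keeps the topology: near a given point all but finitely many words contribute little.\<close>

lemma nonexpansive_metric:
  assumes local: "\<forall>x\<in>X. \<exists>D. openin mtopology D \<and> x \<in> D \<and> shrinks_on D"
  shows "\<exists>e. IFS X e I f \<and> Metric_space.mtopology X e = mtopology \<and>
    (\<forall>x\<in>X. \<forall>y\<in>X. e x y \<le> 2) \<and>
    (\<forall>i\<in>I. \<forall>x\<in>X. \<forall>y\<in>X. e (f i x) (f i y) \<le> e x y) \<and>
    (\<forall>W s. W \<subseteq> X \<longrightarrow> shrinks_on W \<longrightarrow> s > 0 \<longrightarrow> (\<exists>q. 0 \<le> q \<and> q < 1 \<and>
      (\<forall>i\<in>I. \<forall>x\<in>W. \<forall>y\<in>W. s \<le> e x y \<longrightarrow> e (f i x) (f i y) \<le> q * e x y)))"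
proof -
  define c :: "nat \<Rightarrow> real" where "c n = 2 - (1 / 2) ^ n" for n
  have c: "1 \<le> c n" "c n \<le> 2" "c n \<le> c (Suc n)" for n
    by (simp_all add: c_def power_le_one)
  define k where "k w x y = c (length w) * min 1 (d (word_map f w x) (word_map f w y))" for w x y
  define p where "p x y = (SUP w\<in>lists I. k w x y)" for x y
  define e where "e x y = (if x \<in> X \<and> y \<in> X then p x y else 0)" for x y
  have k_le: "k w x y \<le> 2 * \<epsilon>" if "d (word_map f w x) (word_map f w y) \<le> \<epsilon>" for w x y \<epsilon>
  proof -
    have "k w x y \<le> 2 * min 1 (d (word_map f w x) (word_map f w y))"
      unfolding k_def using c by (intro mult_right_mono) auto
    also have "\<dots> \<le> 2 * \<epsilon>" using that by auto
    finally show ?thesis .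
  qed
  have k2: "k w x y \<le> 2" for w x y
  proof -
    have "k w x y \<le> 2 * 1" unfolding k_def using c[of "length w"] by (intro mult_mono) auto
    then show ?thesis by simp
  qed
  have bdd: "bdd_above ((\<lambda>w. k w x y) ` lists I)" for x y
    by (rule bdd_aboveI[of _ 2]) (use k2 in auto)
  have ne: "lists I \<noteq> {}" by blast
  have k_p: "k w x y \<le> p x y" if "w \<in> lists I" for w x y
    unfolding p_def using that bdd by (rule cSUP_upper)
  have p_le: "p x y \<le> a" if "\<And>w. w \<in> lists I \<Longrightarrow> k w x y \<le> a" for x y a
    unfolding p_def using ne that by (rule cSUP_least)
  have "pseudometric_on X (k w)" if "w \<in> lists I" for w
    unfolding k_def
    by (intro pseudometric_on_scale pseudometric_on_min_one pseudometric_on_pullback[OF pseudometric_on_d]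
        word_map_closed that order_trans[OF zero_le_one c(1)])
  then have pm: "pseudometric_on X p"
    unfolding p_def by (intro pseudometric_on_SUP ne bdd) auto
  have finer: "min 1 (d x y) \<le> p x y" for x y
    using k_p[of "[]" x y] by (simp add: k_def c_def)
  have met: "Metric_space X e"
    unfolding e_def
  proof (rule Metric_space_of_pseudometric[OF pm])
    fix x y assume xy: "x \<in> X" "y \<in> X" "p x y = 0"
    then have "d x y = 0" using finer[of x y] nonneg[of x y] by linarith
    then show "x = y" using xy zero by blast
  qed
  interpret E: Metric_space X e by (rule met)
  have cont: "\<exists>U. openin mtopology U \<and> x \<in> U \<and> (\<forall>y\<in>U. e x y < \<epsilon>)" if x: "x \<in> X" and \<epsilon>: "\<epsilon> > 0" for x \<epsilon>
  proof -
    obtain D where D: "openin mtopology D" "x \<in> D" "shrinks_on D" using local x by blast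
    have \<epsilon>4: "\<epsilon> / 4 > 0" using \<epsilon> by simp
    obtain N where N: "\<And>w y. w \<in> lists I \<Longrightarrow> length w \<ge> N \<Longrightarrow> y \<in> D \<Longrightarrow>
        d (word_map f w x) (word_map f w y) \<le> \<epsilon> / 4"
      using D(2,3) \<epsilon>4 unfolding shrinks_on_def by meson
    let ?G = "word_map f ` (\<Union>n<N. fin_words n I)"
    have G: "finite ?G" using I_finite by (simp add: finite_fin_words)
    have G': "continuous_map mtopology mtopology g" if "g \<in> ?G" for g
      using that continuous_word_map by (auto simp: fin_words_eq)
    have "compactin mtopology {x}" using x by simp
    from equicontinuous_near_compact[OF this G G' \<epsilon>4] obtain \<delta> where
      \<delta>: "\<delta> > 0" "\<forall>g\<in>?G. \<forall>a\<in>{x}. \<forall>y\<in>X. d a y < \<delta> \<longrightarrow> d (g a) (g y) < \<epsilon> / 4" by blast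
    have "e x y < \<epsilon>" if y: "y \<in> D \<inter> mball x \<delta>" for y
    proof -
      have "k w x y \<le> 2 * (\<epsilon> / 4)" if w: "w \<in> lists I" for w
      proof (rule k_le, cases "length w \<ge> N")
        case True
        then show "d (word_map f w x) (word_map f w y) \<le> \<epsilon> / 4" using N w y by blast
      next
        case False
        then have "word_map f w \<in> ?G" using w by (auto simp: fin_words_eq)
        moreover have "y \<in> X" "d x y < \<delta>" using y by auto
        ultimately show "d (word_map f w x) (word_map f w y) \<le> \<epsilon> / 4"
          using \<delta>(2) by (meson insertI1 less_imp_le)
      qed
      then have "p x y \<le> 2 * (\<epsilon> / 4)" by (rule p_le)
      then show ?thesis using \<epsilon> by (auto simp: e_def)
    qed
    moreover have "openin mtopology (D \<inter> mball x \<delta>)" using D(1) by (intro openin_Int) auto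
    moreover have "x \<in> D \<inter> mball x \<delta>" using D(2) x \<delta>(1) by simp
    ultimately show ?thesis by blast
  qed
  have finer_e: "min 1 (d x y) \<le> e x y" if "x \<in> X" "y \<in> X" for x y
    using finer[of x y] that by (simp add: e_def)
  have top: "E.mtopology = mtopology"
    by (rule finer_metric_equivalent(1)[OF met finer_e cont])
  have compl: "E.mcomplete"
    by (rule finer_metric_equivalent(2)[OF met finer_e cont]) (simp_all add: complete)
  have k_f: "k w (f i x) (f i y) = c (length w) * min 1 (d (word_map f (w @ [i]) x) (word_map f (w @ [i]) y))"
    for w i x y by (simp add: k_def word_map_append)
  have nonexp: "e (f i x) (f i y) \<le> e x y" if "i \<in> I" "x \<in> X" "y \<in> X" for i x y
  proof -
    have "p (f i x) (f i y) \<le> p x y"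
    proof (rule p_le)
      fix w assume w: "w \<in> lists I"
      have "k w (f i x) (f i y) \<le> k (w @ [i]) x y"
        unfolding k_f k_def[of "w @ [i]"] using c by (intro mult_right_mono) auto
      also have "\<dots> \<le> p x y" using w that by (intro k_p) auto
      finally show "k w (f i x) (f i y) \<le> p x y" .
    qed
    then show ?thesis using that f_closed by (simp add: e_def)
  qed
  have contr: "\<exists>q. 0 \<le> q \<and> q < 1 \<and>
      (\<forall>i\<in>I. \<forall>x\<in>W. \<forall>y\<in>W. s \<le> e x y \<longrightarrow> e (f i x) (f i y) \<le> q * e x y)"
    if W: "W \<subseteq> X" "shrinks_on W" and s: "s > 0" for W s
  proof -
    obtain N where N: "\<And>w x y. w \<in> lists I \<Longrightarrow> length w \<ge> N \<Longrightarrow> x \<in> W \<Longrightarrow> y \<in> W \<Longrightarrow>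
        d (word_map f w x) (word_map f w y) \<le> s / 4"
    proof -
      have "s / 4 > 0" using s by simp
      then show thesis using W(2) that unfolding shrinks_on_def by meson
    qed
    \<comment> \<open>The first bound serves the words \<open>w @ [i]\<close> of length at least \<open>N\<close>, the second bounds \<open>c n / c (Suc n)\<close> for
      \<open>n \<le> N\<close>.\<close>
    define q :: real where "q = max (1 / 2) (1 - (1 / 2) ^ (N + 2))"
    have "e (f i x) (f i y) \<le> q * e x y" if i: "i \<in> I" and xy: "x \<in> W" "y \<in> W" "s \<le> e x y" for i x y
    proof -
      have X: "x \<in> X" "y \<in> X" using xy W(1) by auto
      have e0: "0 \<le> p x y" "s \<le> p x y" using xy(3) s X by (auto simp: e_def)
      have "p (f i x) (f i y) \<le> q * p x y"
      proof (rule p_le)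
        fix w assume w: "w \<in> lists I"
        let ?m = "min 1 (d (word_map f (w @ [i]) x) (word_map f (w @ [i]) y))"
        have wi: "w @ [i] \<in> lists I" using w i by simp
        show "k w (f i x) (f i y) \<le> q * p x y"
        proof (cases "length (w @ [i]) \<ge> N")
          case True
          have "k w (f i x) (f i y) \<le> 2 * (s / 4)"
            using N[OF wi True xy(1,2)] by (intro k_le) (simp add: word_map_append)
          also have "\<dots> \<le> (1 / 2) * p x y" using e0 by simp
          also have "\<dots> \<le> q * p x y" using e0 by (intro mult_right_mono) (auto simp: q_def)
          finally show ?thesis .
        next
          case False
          let ?n = "length w"
          have "(1 / 2) ^ (N + 2) * c (Suc ?n) \<le> (1 / 2) ^ (N + 2) * 2"
            using c by (intro mult_left_mono) auto
          also have "\<dots> = (1 / 2) ^ Suc N" by simp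
          also have "\<dots> \<le> (1 / 2) ^ Suc ?n" using False by (intro power_decreasing) auto
          also have "\<dots> = c (Suc ?n) - c ?n" by (simp add: c_def)
          finally have "c ?n \<le> (1 - (1 / 2) ^ (N + 2)) * c (Suc ?n)" by (simp add: algebra_simps)
          also have "\<dots> \<le> q * c (Suc ?n)" using c(1)[of "Suc ?n"] by (intro mult_right_mono) (auto simp: q_def)
          finally have "c ?n * ?m \<le> (q * c (Suc ?n)) * ?m" by (intro mult_right_mono) auto
          then have "k w (f i x) (f i y) \<le> q * k (w @ [i]) x y"
            unfolding k_f by (simp add: k_def mult.assoc)
          also have "\<dots> \<le> q * p x y" using k_p[OF wi] by (intro mult_left_mono) (auto simp: q_def)
          finally show ?thesis .
        qed
      qed
      then show ?thesis using X i f_closed by (simp add: e_def)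
    qed
    moreover have "0 \<le> q" "q < 1" by (auto simp: q_def)
    ultimately show ?thesis by blast
  qed
  have "e x y \<le> 2" if "x \<in> X" "y \<in> X" for x y
    using that p_le[OF k2] by (simp add: e_def)
  moreover have "IFS X e I f" by (rule IFS_equivalent_metric[OF met top compl nonexp])
  ultimately show ?thesis
    using top nonexp contr by (intro exI[of _ e] conjI ballI allI impI)
qed

text \<open>The new metric is \<open>\<rho> = d + h\<close> with \<open>h x y = (SUP w. 2\<^bsup>|w|\<^esup> * p (f\<^sub>w x) (f\<^sub>w y))\<close>.  The pseudometric
  \<open>p x y = min (d x y) (g x + g y)\<close> allows a shortcut through the zero set of the 1-Lipschitz
  function \<open>g\<close>, at the cost \<open>g x + g y\<close> of reaching and leaving it; \<open>g\<close> vanishes on a neighbourhood \<open>V\<close> of \<open>A\<close> and is at least \<open>r\<close>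
  off \<open>W\<close>.

  Near a given point all words of length at least some \<open>n\<close> lead into \<open>V\<close>, where \<open>p\<close> vanishes, so that
  \<open>h \<le> 2\<^sup>n * d\<close> there; this gives both finiteness of \<open>h\<close> and equivalence of the metrics.  The shift of the
  word length makes every \<open>f i\<close> halve \<open>h\<close>.  Therefore \<open>\<rho>\<close> contracts by a fixed factor whenever
  \<open>h\<close> is comparable to \<open>d\<close> or larger, in particular on pairs not both in \<open>W\<close>; if \<open>h\<close> is small and both
  points are in \<open>W\<close>, the assumed contractivity of \<open>d\<close> on \<open>W\<close> takes over.\<close>

lemma remetrize_contractive:
  assumes le2: "\<And>x y. x \<in> X \<Longrightarrow> y \<in> X \<Longrightarrow> d x y \<le> 2"
    and nonexp: "\<And>i x y. i \<in> I \<Longrightarrow> x \<in> X \<Longrightarrow> y \<in> X \<Longrightarrow> d (f i x) (f i y) \<le> d x y"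
    and A: "compactin mtopology A" "A \<noteq> {}"
    and absorb: "\<And>V x. openin mtopology V \<Longrightarrow> A \<subseteq> V \<Longrightarrow> x \<in> X \<Longrightarrow> \<exists>D n. openin mtopology D \<and> x \<in> D \<and>
      (\<forall>w\<in>lists I. n \<le> length w \<longrightarrow> word_map f w ` D \<subseteq> V)"
    and W: "openin mtopology W" "A \<subseteq> W"
    and contr: "\<And>s. s > 0 \<Longrightarrow> \<exists>q. 0 \<le> q \<and> q < 1 \<and>
      (\<forall>i\<in>I. \<forall>x\<in>W. \<forall>y\<in>W. s \<le> d x y \<longrightarrow> d (f i x) (f i y) \<le> q * d x y)"
  shows "\<exists>\<phi>. comparison_function \<phi> \<and> hyperbolic X d I f (\<lambda>d1. IFS.phi_contractive X d1 I f \<phi>)"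
proof -
  have AX: "A \<subseteq> X" using W openin_subset by fastforce
  obtain \<delta> where \<delta>: "\<delta> > 0" "\<forall>a\<in>A. \<forall>y\<in>X. d a y < \<delta> \<longrightarrow> y \<in> W"
    using uniform_neighbourhood_of_compact[OF A(1) W] by blast
  \<comment> \<open>Half of \<open>\<delta>\<close> is spent on \<open>V\<close>, the other half is the lower bound for \<open>g\<close> off \<open>W\<close>.\<close>
  define r where "r = \<delta> / 2"
  have r: "r > 0" using \<delta> by (simp add: r_def)
  define V where "V = (\<Union>a\<in>A. mball a r)"
  have V: "openin mtopology V" "A \<subseteq> V" using AX r by (auto simp: V_def)
  define g where "g x = max 0 (set_dist x A - r)" for x
  have g0: "g x = 0" if "x \<in> V" for x
  proof -
    from that obtain a where a: "a \<in> A" "d a x < r" by (auto simp: V_def)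
    then have "set_dist x A < r" using set_dist_le[OF a(1), of x] by (simp add: commute)
    then show ?thesis by (simp add: g_def)
  qed
  have g_far: "r \<le> g x" if "x \<in> X" "x \<notin> W" for x
  proof -
    have "\<not> set_dist x A < \<delta>" using set_dist_lessD[of x A \<delta>] \<delta>(2) that A(2) by (auto simp: commute)
    then show ?thesis unfolding g_def r_def by linarith
  qed
  have g_nonneg: "0 \<le> g x" for x by (simp add: g_def)
  have g_Lip: "g x \<le> d x y + g y" if "x \<in> X" "y \<in> X" for x y
    using set_dist_Lipschitz[OF AX A(2) that] nonneg[of x y] by (simp add: g_def)
  define p where "p x y = min (d x y) (g x + g y)" for x y
  have pm_p: "pseudometric_on X p"
    unfolding pseudometric_on_def
  proof (intro conjI ballI)
    fix x y z assume xyz: "x \<in> X" "y \<in> X" "z \<in> X"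
    show "p x z \<le> p x y + p y z"
      using triangle[OF xyz] g_Lip[of x y] g_Lip[of z y] xyz g_nonneg[of y] commute[of z y]
      unfolding p_def by linarith
  qed (auto simp: p_def g_nonneg commute add.commute min_def)
  define k where "k w x y = 2 ^ length w * p (word_map f w x) (word_map f w y)" for w x y
  define h where "h x y = (SUP w\<in>lists I. k w x y)" for x y
  define \<rho> where "\<rho> x y = (if x \<in> X \<and> y \<in> X then d x y + h x y else 0)" for x y
  have nonexp_word: "d (word_map f w x) (word_map f w y) \<le> d x y"
    if w: "w \<in> lists I" and xy: "x \<in> X" "y \<in> X" for w x y
    using w
  proof (induction w)
    case (Cons i w)
    then have "d (word_map f (i # w) x) (word_map f (i # w) y) \<le> d (word_map f w x) (word_map f w y)"
      using xy word_map_closed by (simp add: nonexp)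
    then show ?case using Cons by simp
  qed simp
  have k_le: "k w x y \<le> 2 ^ n * d x y"
    if w: "w \<in> lists I" and xy: "x \<in> X" "y \<in> X"
      and n: "\<And>w. w \<in> lists I \<Longrightarrow> n \<le> length w \<Longrightarrow> word_map f w x \<in> V \<and> word_map f w y \<in> V" for w x y n
  proof (cases "n \<le> length w")
    case True
    then have "k w x y = 0" using n[OF w] g0 by (simp add: k_def p_def)
    then show ?thesis by simp
  next
    case False
    have "p (word_map f w x) (word_map f w y) \<le> d x y"
      using nonexp_word[OF w xy] by (simp add: p_def)
    moreover have "(2::real) ^ length w \<le> 2 ^ n" using False by (intro power_increasing) auto
    ultimately show ?thesis unfolding k_def by (intro mult_mono) (auto simp: p_def g_nonneg)
  qed
  have near: "\<exists>D n. openin mtopology D \<and> x \<in> D \<and> (\<forall>y\<in>D. \<forall>w\<in>lists I. n \<le> length w \<longrightarrow> word_map f w y \<in> V)"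
    if "x \<in> X" for x using absorb[OF V that] by blast
  have bdd: "bdd_above ((\<lambda>w. k w x y) ` lists I)" if xy: "x \<in> X" "y \<in> X" for x y
  proof -
    obtain n m where "\<And>w. w \<in> lists I \<Longrightarrow> n \<le> length w \<Longrightarrow> word_map f w x \<in> V"
      "\<And>w. w \<in> lists I \<Longrightarrow> m \<le> length w \<Longrightarrow> word_map f w y \<in> V"
      using near[OF xy(1)] near[OF xy(2)] by meson
    then have "k w x y \<le> 2 ^ max n m * d x y" if "w \<in> lists I" for w
      using that xy by (intro k_le) auto
    then show ?thesis by (intro bdd_aboveI[of _ "2 ^ max n m * d x y"]) auto
  qed
  have ne: "lists I \<noteq> {}" by blast
  have k_h: "k w x y \<le> h x y" if "w \<in> lists I" "x \<in> X" "y \<in> X" for w x y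
    unfolding h_def using that bdd by (intro cSUP_upper)
  have h_le: "h x y \<le> a" if "\<And>w. w \<in> lists I \<Longrightarrow> k w x y \<le> a" for x y a
    unfolding h_def using ne that by (rule cSUP_least)
  have "pseudometric_on X (k w)" if "w \<in> lists I" for w
    unfolding k_def by (intro pseudometric_on_scale pseudometric_on_pullback[OF pm_p] word_map_closed that) auto
  then have pm_h: "pseudometric_on X h"
    unfolding h_def by (intro pseudometric_on_SUP ne bdd) auto
  have h_nonneg: "0 \<le> h x y" if "x \<in> X" "y \<in> X" for x y
    using pm_h that by (auto simp: pseudometric_on_def)
  have met: "Metric_space X \<rho>"
    unfolding \<rho>_def
  proof (rule Metric_space_of_pseudometric[OF pseudometric_on_add[OF pseudometric_on_d pm_h]])
    fix x y assume xy: "x \<in> X" "y \<in> X" "d x y + h x y = 0"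
    then have "d x y = 0" using h_nonneg[of x y] nonneg[of x y] by linarith
    then show "x = y" using xy zero by blast
  qed
  interpret R: Metric_space X \<rho> by (rule met)
  have finer: "min 1 (d x y) \<le> \<rho> x y" if "x \<in> X" "y \<in> X" for x y
    using h_nonneg[OF that] that by (simp add: \<rho>_def)
  have cont: "\<exists>U. openin mtopology U \<and> x \<in> U \<and> (\<forall>y\<in>U. \<rho> x y < \<epsilon>)" if x: "x \<in> X" and \<epsilon>: "\<epsilon> > 0" for x \<epsilon>
  proof -
    obtain D n where D: "openin mtopology D" "x \<in> D"
      "\<And>y w. y \<in> D \<Longrightarrow> w \<in> lists I \<Longrightarrow> n \<le> length w \<Longrightarrow> word_map f w y \<in> V"
      using near[OF x] by blast
    define \<eta> where "\<eta> = \<epsilon> / (1 + 2 ^ n)"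
    have pos: "(0::real) < 1 + 2 ^ n" by (simp add: add_pos_pos)
    have "\<rho> x y < \<epsilon>" if y: "y \<in> D \<inter> mball x \<eta>" for y
    proof -
      have yX: "y \<in> X" "d x y < \<eta>" using y by auto
      have "h x y \<le> 2 ^ n * d x y" using D y x yX by (intro h_le k_le) auto
      then have "\<rho> x y \<le> (1 + 2 ^ n) * d x y" using x yX by (simp add: \<rho>_def distrib_right)
      also have "\<dots> < (1 + 2 ^ n) * \<eta>" using yX pos by (intro mult_strict_left_mono)
      also have "\<dots> = \<epsilon>" using pos by (simp add: \<eta>_def)
      finally show ?thesis .
    qed
    moreover have "openin mtopology (D \<inter> mball x \<eta>)" using D(1) by (intro openin_Int) auto
    moreover have "x \<in> D \<inter> mball x \<eta>" using D(2) x \<epsilon> pos by (simp add: \<eta>_def)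
    ultimately show ?thesis by blast
  qed
  have top: "R.mtopology = mtopology"
    by (rule finer_metric_equivalent(1)[OF met finer cont])
  have compl: "R.mcomplete"
    by (rule finer_metric_equivalent(2)[OF met finer cont]) (simp_all add: complete)
  have halve: "h (f i x) (f i y) \<le> h x y / 2" if "i \<in> I" "x \<in> X" "y \<in> X" for i x y
  proof (rule h_le)
    fix w assume w: "w \<in> lists I"
    have "k (w @ [i]) x y \<le> h x y" using w that by (intro k_h) auto
    then show "k w (f i x) (f i y) \<le> h x y / 2" by (simp add: k_def word_map_append)
  qed
  have p_h: "p x y \<le> h x y" if "x \<in> X" "y \<in> X" for x y
    using k_h[of "[]" x y] that by (simp add: k_def)
  \<comment> \<open>The bound \<open>d \<le> 2\<close> turns the constant \<open>r\<close> into a multiple of \<open>d\<close>: \<open>r \<ge> (r / 2) * d\<close>.\<close>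
  define \<kappa> where "\<kappa> = min 1 (r / 2)"
  have \<kappa>: "0 < \<kappa>" "\<kappa> \<le> 1" using r by (auto simp: \<kappa>_def)
  have far: "\<kappa> * d x y \<le> h x y" if xy: "x \<in> X" "y \<in> X" and "\<not> (x \<in> W \<and> y \<in> W)" for x y
  proof -
    have "r \<le> g x + g y" using that g_far[of x] g_far[of y] g_nonneg[of x] g_nonneg[of y] by auto
    moreover have "\<kappa> * d x y \<le> 1 * d x y" using \<kappa> by (intro mult_right_mono) auto
    moreover have "\<kappa> * d x y \<le> (r / 2) * 2"
      using le2[OF xy] r by (intro mult_mono) (auto simp: \<kappa>_def)
    ultimately have "\<kappa> * d x y \<le> p x y" by (simp add: p_def)
    then show ?thesis using p_h[OF xy] by simp
  qed
  have \<rho>_eq: "\<rho> x y = d x y + h x y" if "x \<in> X" "y \<in> X" for x y using that by (simp add: \<rho>_def)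
  have nonexp_\<rho>: "\<rho> (f i x) (f i y) \<le> \<rho> x y" if "i \<in> I" "x \<in> X" "y \<in> X" for i x y
    using nonexp[OF that] halve[OF that] h_nonneg[OF that(2,3)] that f_closed by (simp add: \<rho>_eq)
  define R where "R = {(\<rho> x y, \<rho> (f i x) (f i y)) | x y i. i \<in> I \<and> x \<in> X \<and> y \<in> X}"
  have "\<exists>\<phi>. comparison_function \<phi> \<and> (\<forall>(t, t')\<in>R. t' \<le> \<phi> t)"
  proof (rule comparison_function_of_ratios)
    show "0 \<le> t \<and> t' \<le> t" if "(t, t') \<in> R" for t t'
      using that nonexp_\<rho> by (auto simp: R_def)
  next
    fix s :: real assume s: "s > 0"
    then obtain q where q: "0 \<le> q" "q < 1"
      "\<And>i x y. i \<in> I \<Longrightarrow> x \<in> W \<Longrightarrow> y \<in> W \<Longrightarrow> s / 2 \<le> d x y \<Longrightarrow> d (f i x) (f i y) \<le> q * d x y"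
      using contr[of "s / 2"] by auto
    \<comment> \<open>One factor for each case: \<open>x\<close> and \<open>y\<close> in \<open>W\<close> with \<open>d x y \<ge> s / 2\<close> (where \<open>h\<close> is halved and
      \<open>q \<le> q'\<close>, \<open>1 / 2 \<le> q'\<close>); \<open>d x y < s / 2\<close>, hence \<open>d x y \<le> h x y\<close>; \<open>x\<close> or \<open>y\<close> outside \<open>W\<close>, hence
      \<open>\<kappa> * d x y \<le> h x y\<close>.\<close>
    define q' where "q' = max (max q (3 / 4)) (1 - \<kappa> / 4)"
    have q': "0 \<le> q'" "q' < 1" "q \<le> q'" "3 / 4 \<le> q'" "1 - \<kappa> / 4 \<le> q'"
      unfolding q'_def le_max_iff_disj max_less_iff_conj using q \<kappa> by auto
    have "\<rho> (f i x) (f i y) \<le> q' * \<rho> x y"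
      if i: "i \<in> I" and xy: "x \<in> X" "y \<in> X" and "s \<le> \<rho> x y" for i x y
    proof -
      let ?d = "d x y" and ?h = "h x y"
      have h0: "0 \<le> ?h" "0 \<le> ?d" using h_nonneg[OF xy] by auto
      have ge: "c * (?d + ?h) \<le> q' * (?d + ?h)" if "c \<le> q'" for c
        using h0 that by (intro mult_right_mono) auto
      have f: "\<rho> (f i x) (f i y) \<le> d (f i x) (f i y) + ?h / 2"
        using halve[OF i xy] f_closed i xy by (simp add: \<rho>_eq)
      have dle: "d (f i x) (f i y) \<le> ?d" by (rule nonexp[OF i xy])
      consider "x \<in> W \<and> y \<in> W" "s / 2 \<le> ?d" | "?d < s / 2" | "\<not> (x \<in> W \<and> y \<in> W)" by linarith
      then have "\<rho> (f i x) (f i y) \<le> q' * (?d + ?h)"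
      proof cases
        case 1
        have "\<rho> (f i x) (f i y) \<le> q * ?d + (1 / 2) * ?h" using f q(3)[OF i _ _ 1(2)] 1(1) by simp
        also have "\<dots> \<le> q' * ?d + q' * ?h" using q' h0 by (intro add_mono mult_right_mono) auto
        finally show ?thesis by (simp add: distrib_left)
      next
        case 2
        then have "?d \<le> ?h" using \<open>s \<le> \<rho> x y\<close> by (simp add: \<rho>_eq[OF xy])
        then have "\<rho> (f i x) (f i y) \<le> 3 / 4 * (?d + ?h)" using f dle by simp
        then show ?thesis using ge[OF q'(4)] by linarith
      next
        case 3
        have "\<kappa> * ?d \<le> ?h" "\<kappa> * ?h \<le> 1 * ?h"
          using far[OF xy 3] mult_right_mono[OF \<kappa>(2) h0(1)] by auto
        then have "\<rho> (f i x) (f i y) \<le> (1 - \<kappa> / 4) * (?d + ?h)" using f dle by (simp add: algebra_simps)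
        then show ?thesis using ge[OF q'(5)] by linarith
      qed
      then show ?thesis by (simp add: \<rho>_eq[OF xy])
    qed
    then show "\<exists>q. 0 \<le> q \<and> q < 1 \<and> (\<forall>(t, t')\<in>R. s \<le> t \<longrightarrow> t' \<le> q * t)"
      using q' by (intro exI[of _ q']) (auto simp: R_def)
  qed
  then obtain \<phi> where \<phi>: "comparison_function \<phi>" "\<And>t t'. (t, t') \<in> R \<Longrightarrow> t' \<le> \<phi> t" by blast
  have IFS': "IFS X \<rho> I f"
    by (rule IFS_equivalent_metric[OF met top compl nonexp_\<rho>])
  have "IFS.phi_contractive X \<rho> I f \<phi>"
    unfolding IFS.phi_contractive_def[OF IFS'] using \<phi>(2) unfolding R_def by blast
  then show ?thesis using \<phi>(1) IFS' top unfolding hyperbolic_def by blast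
qed

text \<open>The fibre set is compact, so finitely many of the given neighbourhoods cover it; their union is the set
  \<open>W\<close> of the two preceding constructions.  That neighbourhoods of points are eventually mapped into any
  neighbourhood of the fibre set is a topological statement, so it can be proved for \<open>d\<close> and used
  for the metric obtained in the first step.\<close>

lemma locally_uniformly_point_fibred_imp_hyperbolic_phi_contractive:
  assumes L: "locally_uniformly_point_fibred"
  shows "\<exists>\<phi>. comparison_function \<phi> \<and> hyperbolic X d I f (\<lambda>d1. IFS.phi_contractive X d1 I f \<phi>)"
proof -
  have pf: "point_fibred"
    and local: "\<And>x. x \<in> X \<Longrightarrow> \<exists>D. openin mtopology D \<and> x \<in> D \<and> uniform_fibres_on D"
    using L unfolding locally_uniformly_point_fibred_def max_deviation_tendsto_0_iff by auto
  have DX: "D \<subseteq> X" if "openin mtopology D" for D using openin_subset[OF that] by simp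
  from X_nonempty obtain x0 where x0: "x0 \<in> X" by blast
  then have "uniform_fibres_on {x0}" using local[OF x0] uniform_fibres_on_subset[of _ "{x0}"] by blast
  from compactin_word_image[OF continuous_fibre_point[OF pf x0 this]]
  have cpt: "compactin mtopology fibre_set" by (simp add: fibre_set_def)
  have FX: "fibre_set \<subseteq> X" using compactin_subset_topspace[OF cpt] by simp
  let ?\<U> = "{D. openin mtopology D \<and> uniform_fibres_on D}"
  have "fibre_set \<subseteq> \<Union>?\<U>" using local FX by blast
  then obtain \<D> where \<D>: "finite \<D>" "\<D> \<subseteq> ?\<U>" "fibre_set \<subseteq> \<Union>\<D>"
    using compactinD[OF cpt, of ?\<U>] by blast
  define W where "W = \<Union>\<D>"
  have W: "openin mtopology W" "fibre_set \<subseteq> W" "uniform_fibres_on W"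
    using \<D> uniform_fibres_on_Union[OF \<D>(1)] by (auto simp: W_def)
  have absorb: "\<exists>D n. openin mtopology D \<and> x \<in> D \<and> (\<forall>w\<in>lists I. n \<le> length w \<longrightarrow> word_map f w ` D \<subseteq> V)"
    if V: "openin mtopology V" "fibre_set \<subseteq> V" and x: "x \<in> X" for V x
  proof -
    obtain D where D: "openin mtopology D" "x \<in> D" "uniform_fibres_on D" using local[OF x] by blast
    obtain \<delta> where \<delta>: "\<delta> > 0" "\<forall>a\<in>fibre_set. \<forall>y\<in>X. d a y < \<delta> \<longrightarrow> y \<in> V"
      using uniform_neighbourhood_of_compact[OF cpt V] by blast
    obtain \<omega> where \<omega>: "\<omega> \<in> inf_words I" using extend_to_inf_word[of "[]" I] I_nonempty by auto
    obtain N where N: "\<And>w y. w \<in> lists I \<Longrightarrow> length w \<ge> N \<Longrightarrow> y \<in> D \<Longrightarrow>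
        d (word_map f w y) (fibre_point (prepend_word w \<omega>)) \<le> \<delta> / 2"
      using D(3) half_gt_zero[OF \<delta>(1)] \<omega> unfolding uniform_fibres_on_def by meson
    have "word_map f w y \<in> V" if w: "w \<in> lists I" "N \<le> length w" "y \<in> D" for w y
    proof -
      have "fibre_point (prepend_word w \<omega>) \<in> fibre_set"
        unfolding fibre_set_def using prepend_word_inf_words[OF w(1) \<omega>] by blast
      moreover have "word_map f w y \<in> X" using w DX[OF D(1)] by (intro word_map_closed) auto
      moreover have "d (fibre_point (prepend_word w \<omega>)) (word_map f w y) < \<delta>"
        using N[OF w] \<delta>(1) by (simp add: commute)
      ultimately show ?thesis using \<delta>(2) by blast
    qed
    then show ?thesis using D by blast
  qed
  have "\<forall>x\<in>X. \<exists>D. openin mtopology D \<and> x \<in> D \<and> shrinks_on D"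
    using local uniform_fibres_on_imp_shrinks_on[OF pf _ DX] by blast
  from nonexpansive_metric[OF this] obtain e where e: "IFS X e I f"
    "Metric_space.mtopology X e = mtopology" "\<forall>x\<in>X. \<forall>y\<in>X. e x y \<le> 2"
    "\<forall>i\<in>I. \<forall>x\<in>X. \<forall>y\<in>X. e (f i x) (f i y) \<le> e x y"
    "\<forall>W s. W \<subseteq> X \<longrightarrow> shrinks_on W \<longrightarrow> s > 0 \<longrightarrow> (\<exists>q. 0 \<le> q \<and> q < 1 \<and>
      (\<forall>i\<in>I. \<forall>x\<in>W. \<forall>y\<in>W. s \<le> e x y \<longrightarrow> e (f i x) (f i y) \<le> q * e x y))"
    by (elim exE conjE) (rule that)
  have WX: "W \<subseteq> X" "shrinks_on W"
    using DX[OF W(1)] uniform_fibres_on_imp_shrinks_on[OF pf W(3)] by auto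
  interpret E: IFS X e I f by (rule e(1))
  have "\<exists>\<phi>. comparison_function \<phi> \<and> hyperbolic X e I f (\<lambda>d1. IFS.phi_contractive X d1 I f \<phi>)"
  proof (rule E.remetrize_contractive[of fibre_set W, unfolded e(2)])
    show "\<exists>q. 0 \<le> q \<and> q < 1 \<and>
        (\<forall>i\<in>I. \<forall>x\<in>W. \<forall>y\<in>W. s \<le> e x y \<longrightarrow> e (f i x) (f i y) \<le> q * e x y)" if "s > 0" for s
      using e(5) WX that by simp
  qed (fact cpt fibre_set_nonempty absorb W(1,2) | simp add: e(3,4))+
  then show ?thesis unfolding hyperbolic_def e(2) .
qed

end

section \<open>The equivalence\<close>

theorem theorem4p1:
  fixes X :: "'a set" and d :: "'a \<Rightarrow> 'a \<Rightarrow> real"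
    and I :: "'i set" and f :: "'i \<Rightarrow> 'a \<Rightarrow> 'a"
  assumes "IFS X d I f"
  shows
    "((\<exists>\<phi>. comparison_function \<phi> \<and> hyperbolic X d I f (\<lambda>d1. IFS.phi_contractive X d1 I f \<phi>))
       \<longleftrightarrow> hyperbolic X d I f (\<lambda>d1. IFS.locally_uniformly_point_fibred X d1 I f)) \<and>
     (hyperbolic X d I f (\<lambda>d1. IFS.locally_uniformly_point_fibred X d1 I f)
       \<longleftrightarrow> hyperbolic X d I f (\<lambda>d1. IFS.uniformly_point_fibred X d1 I f)) \<and>
     (hyperbolic X d I f (\<lambda>d1. IFS.uniformly_point_fibred X d1 I f)
       \<longleftrightarrow> hyperbolic X d I f (\<lambda>d1. IFS.diameter_diminishing X d1 I f)) \<and>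
     (hyperbolic X d I f (\<lambda>d1. IFS.diameter_diminishing X d1 I f)
       \<longleftrightarrow> (\<exists>A. hyperbolic X d I f (\<lambda>d1. IFS.is_attractor X d1 I f A) \<and>
             (\<exists>\<pi>. continuous_map (Metric_space.mtopology (inf_words I) word_dist)
                     (subtopology (Metric_space.mtopology X d) A) \<pi> \<and>
                  \<pi> ` inf_words I = A \<and>
                  (\<forall>i\<in>I. \<forall>\<omega>\<in>inf_words I. f i (\<pi> \<omega>) = \<pi> (shift_in i \<omega>)))))"
    (is "(?phi \<longleftrightarrow> ?local) \<and> (_ \<longleftrightarrow> ?unif) \<and> (_ \<longleftrightarrow> ?diam) \<and> (_ \<longleftrightarrow> ?attr)")
proof -
  have phi_unif: ?unif if ?phi
    using that IFS.phi_contractive_imp_uniformly_point_fibred unfolding hyperbolic_def by blast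
  have unif_local: ?local if ?unif
    using that IFS.uniformly_point_fibred_imp_locally unfolding hyperbolic_def by blast
  have local_phi: ?phi if ?local
  proof -
    from that obtain e where e: "IFS X e I f" "Metric_space.mtopology X e = Metric_space.mtopology X d"
      "IFS.locally_uniformly_point_fibred X e I f" unfolding hyperbolic_def by blast
    from IFS.locally_uniformly_point_fibred_imp_hyperbolic_phi_contractive[OF e(1,3)]
    show ?thesis unfolding hyperbolic_def e(2) .
  qed
  have unif_diam: "?unif \<longleftrightarrow> ?diam"
    using IFS.uniformly_point_fibred_imp_diameter_diminishing
      IFS.diameter_diminishing_imp_uniformly_point_fibred unfolding hyperbolic_def by blast
  have unif_attr: ?attr if ?unif
  proof -
    from that obtain e where e: "IFS X e I f" "Metric_space.mtopology X e = Metric_space.mtopology X d"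
      "IFS.uniformly_point_fibred X e I f" unfolding hyperbolic_def by blast
    interpret E: IFS X e I f by (rule e(1))
    have pf: "E.point_fibred" and unif: "\<And>B. E.mbounded B \<Longrightarrow> E.uniform_fibres_on B"
      using e(3) E.uniformly_point_fibred_iff by auto
    from E.X_nonempty obtain x0 where x0: "x0 \<in> X" by blast
    have "continuous_map (Metric_space.mtopology (inf_words I) word_dist) E.mtopology E.fibre_point"
      by (rule E.continuous_fibre_point[OF pf x0 unif]) (simp add: E.mbounded_insert x0)
    then have "continuous_map (Metric_space.mtopology (inf_words I) word_dist)
        (subtopology (Metric_space.mtopology X d) E.fibre_set) E.fibre_point"
      unfolding continuous_map_in_subtopology e(2)
      using Metric_space.topspace_mtopology[OF Metric_space_words[of I]] by (auto simp: E.fibre_set_def)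
    moreover have "\<forall>i\<in>I. \<forall>\<omega>\<in>inf_words I. f i (E.fibre_point \<omega>) = E.fibre_point (shift_in i \<omega>)"
      using E.fibre_point_shift_in[OF pf] by blast
    moreover have "hyperbolic X d I f (\<lambda>d1. IFS.is_attractor X d1 I f E.fibre_set)"
      unfolding hyperbolic_def using e E.uniformly_point_fibred_imp_is_attractor[OF e(3)] by blast
    ultimately show ?thesis using E.fibre_set_def by blast
  qed
  have attr_local: ?local if ?attr
  proof -
    from that obtain A \<pi> e where e: "IFS X e I f" "Metric_space.mtopology X e = Metric_space.mtopology X d"
      "IFS.is_attractor X e I f A"
      and \<pi>: "continuous_map (Metric_space.mtopology (inf_words I) word_dist)
          (subtopology (Metric_space.mtopology X d) A) \<pi>" "\<pi> ` inf_words I = A"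
        "\<And>i \<omega>. i \<in> I \<Longrightarrow> \<omega> \<in> inf_words I \<Longrightarrow> f i (\<pi> \<omega>) = \<pi> (shift_in i \<omega>)"
      unfolding hyperbolic_def by blast
    have "continuous_map (Metric_space.mtopology (inf_words I) word_dist) (Metric_space.mtopology X e) \<pi>"
      using \<pi>(1) unfolding e(2) by (simp add: continuous_map_in_subtopology)
    from IFS.attractor_imp_locally_uniformly_point_fibred[OF e(1,3) this \<pi>(2,3)]
    show ?thesis using e(1,2) unfolding hyperbolic_def by blast
  qed
  from phi_unif unif_local local_phi unif_diam unif_attr attr_local show ?thesis by blast
qed

end
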